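(* Consider the Milnor module $S^*[[x_1,x_2]]$ over the Landweber–Novikov algebra $S$, in which $x_1,x_2$ are geometric cobordism elements. There exists a unique series $$x=f(x_1,x_2)=x_1+x_2+\sum_{i,j\ge1}\alpha_{ij}x_1^ix_2^j,\qquad \alpha_{ij}\in S^*,$$ such that $x=f(x_1,x_2)$ is a geometric cobordism element, i.e. $x$ is homogeneous of degree $2$, $s_{(k)}(x)=x^{k+1}$ for all $k\ge1$, and $s_w(x)=0$ for all $w=(k_1,\dots,k_l)$ with $l>1$.
   Context: The Landweber–Novikov algebra $S$ is the Hopf algebra over $\mathbb Z$ defined as follows. Additively it is free abelian with basis $s_w$, where $w=(k_1,\dots,k_l)$ runs over finite unordered collections of positive integers including the empty one; $s_\emptyset=1$, and $s_w$ has degree $\deg w=2\sum_j k_j$. The coproduct is $\Delta s_w=\sum_{(w',w'')=w}s_{w'}\otimes s_{w''}$ (sum over splittings of the collection $w$ into two collections). On polynomial rings $\mathbb Z[y_1,\dots,y_N]$ the $s_w$ act by $s_{(k)}(y_j)=y_j^{k+1}$, $s_w(y_j)=0$ if $l>1$, and the Cartan formula $s_w(uv)=\sum_{(w',w'')=w}s_{w'}(u)s_{w''}(v)$; the product of $S$ is the unique one making these rings left $S$-modules for all $N$ (for every $s\in S$, $s\neq0$, one has $s(y_1\cdots y_N)\ne0$ for $N$ large). $S^*$ is the (graded) dual Hopf algebra: the polynomial ring over $\mathbb Z$ on generators $s_k^*$, $k\ge1$, where $(s_k^*,s_w)=1$ if $w=(k)$ and $0$ otherwise; it is graded in non-positive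 degrees, $\deg s_k^*=-2k$. $S$ acts on $S^*$ by $s(\lambda)=R_s^*(\lambda)$, where $(R_s^*(\lambda),s')=(\lambda,s's)$ for $s,s'\in S$. A Milnor module over $S$ is a ring on which $S$ acts with $s(uv)=\sum s_i'(u)s_i''(v)$ whenever $\Delta s=\sum s_i'\otimes s_i''$. The formal power series ring $S^*[[x_1,x_2]]$, with $\deg x_1=\deg x_2=2$, is a Milnor module via $s(\lambda)=R_s^*(\lambda)$ for $\lambda\in S^*$, $s_{(k)}(x_j)=x_j^{k+1}$, $s_w(x_j)=0$ for $w=(k_1,\dots,k_l)$ with $l>1$, and the Milnor module identity. *)

theory Defs
  imports
    "HOL-Library.Multiset"
    "HOL-Library.Poly_Mapping"
    "HOL-Computational_Algebra.Formal_Power_Series"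
begin

section \<open>The Landweber--Novikov algebra as a coalgebra\<close>

text \<open>
  The type \<^typ>\<open>num\<close> of strictly positive binary numerals serves as the type of positive
  integers, so a finite unordered collection of positive integers is a multiset over it.

  \<open>ln\<close> is the free abelian group on these collections. The product of the Landweber--Novikov
  algebra is \<open>ln_mult\<close> below; it is not the product \<open>*\<close> that the library puts on this type.
  The latter is the product of the dual, see \<open>ln_dual\<close>. The two units coincide.
\<close>

type_synonym collection = "num multiset"

type_synonym ln = "collection \<Rightarrow>\<^sub>0 int"

definition s_op :: "collection \<Rightarrow> ln" where
  "s_op w = Poly_Mapping.single w 1"

definition deg :: "collection \<Rightarrow> nat" where
  "deg w = 2 * (\<Sum>k\<in>#w. nat_of_num k)"

definition splittings :: "collection \<Rightarrow> (collection \<times> collection) set" where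
  "splittings w = {(w', w''). w' + w'' = w}"

text \<open>The tensor square of \<open>ln\<close> is the free abelian group on pairs of collections.\<close>

type_synonym ln_tensor = "(collection \<times> collection) \<Rightarrow>\<^sub>0 int"

definition tensor :: "ln \<Rightarrow> ln \<Rightarrow> ln_tensor" where
  "tensor s t = (\<Sum>a\<in>Poly_Mapping.keys s. \<Sum>b\<in>Poly_Mapping.keys t.
     Poly_Mapping.single (a, b) (Poly_Mapping.lookup s a * Poly_Mapping.lookup t b))"

definition coproduct :: "ln \<Rightarrow> ln_tensor" where
  "coproduct s = (\<Sum>w\<in>Poly_Mapping.keys s. \<Sum>(w', w'')\<in>splittings w.
     Poly_Mapping.single (w', w'') (Poly_Mapping.lookup s w))"

lemma finite_splittings: "finite (splittings w)"
proof -
  have "splittings w \<subseteq> (\<lambda>a. (a, w - a)) ` {a. a \<subseteq># w}"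
    by (auto simp: splittings_def image_iff)
  moreover have "finite {a. a \<subseteq># w}"
  proof -
    have "{a. a \<subseteq># w} \<subseteq> (\<lambda>xs. mset xs) ` {xs. set xs \<subseteq> set_mset w \<and> length xs \<le> size w}"
    proof
      fix a assume "a \<in> {a. a \<subseteq># w}"
      then have a: "a \<subseteq># w" by simp
      obtain xs where xs: "mset xs = a" using ex_mset by blast
      have "set xs \<subseteq> set_mset w" "length xs \<le> size w"
        using a xs set_mset_mono[OF a] size_mset_mono[OF a] by auto
      then show "a \<in> (\<lambda>xs. mset xs) ` {xs. set xs \<subseteq> set_mset w \<and> length xs \<le> size w}"
        using xs by auto
    qed
    then show ?thesis
      using finite_lists_length_le[of "set_mset w"] finite_subset by blast
  qed
  ultimately show ?thesis
    using finite_subset by blast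
qed

lemma coproduct_s_op:
  "coproduct (s_op w) = (\<Sum>(w', w'')\<in>splittings w. tensor (s_op w') (s_op w''))"
  by (simp add: coproduct_def tensor_def s_op_def)


section \<open>Operations on rings\<close>

text \<open>
  The next predicate collects the requirements on an action that do not refer to the product of
  the algebra: it is biadditive, the unit acts as the identity, and the Cartan formula holds.
\<close>

definition cartan_action :: "(ln \<Rightarrow> 'a \<Rightarrow> 'a::comm_ring_1) \<Rightarrow> bool" where
  "cartan_action act \<longleftrightarrow>
     (\<forall>s u v. act s (u + v) = act s u + act s v) \<and>
     (\<forall>s t u. act (s + t) u = act s u + act t u) \<and>
     (\<forall>u. act (s_op {#}) u = u) \<and>
     (\<forall>s ps u v. coproduct s = (\<Sum>(s', s'')\<leftarrow>ps. tensor s' s'') \<longrightarrow>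
        act s (u * v) = (\<Sum>(s', s'')\<leftarrow>ps. act s' u * act s'' v))"

definition geometric_values :: "(ln \<Rightarrow> 'a \<Rightarrow> 'a::comm_ring_1) \<Rightarrow> 'a \<Rightarrow> bool" where
  "geometric_values act x \<longleftrightarrow>
     (\<forall>k. act (s_op {#k#}) x = x ^ (nat_of_num k + 1)) \<and>
     (\<forall>w. size w > 1 \<longrightarrow> act (s_op w) x = 0)"


section \<open>The product of the Landweber--Novikov algebra\<close>

text \<open>
  Integer polynomials in the variables \<open>yvar 1, yvar 2, \<dots>\<close> (together with an unused \<open>yvar 0\<close>);
  \<open>poly_ring N\<close> is the subring of polynomials in \<open>yvar 1, \<dots>, yvar N\<close>. The actions on these
  subrings are restrictions of a single action on the whole ring.
\<close>

type_synonym int_mpoly = "(nat \<Rightarrow>\<^sub>0 nat) \<Rightarrow>\<^sub>0 int"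

definition yvar :: "nat \<Rightarrow> int_mpoly" where
  "yvar j = Poly_Mapping.single (Poly_Mapping.single j 1) 1"

definition poly_ring :: "nat \<Rightarrow> int_mpoly set" where
  "poly_ring N = {p. \<forall>m\<in>Poly_Mapping.keys p. Poly_Mapping.keys m \<subseteq> {1..N}}"

definition poly_act :: "ln \<Rightarrow> int_mpoly \<Rightarrow> int_mpoly" where
  "poly_act = (THE act. cartan_action act \<and> (\<forall>j. geometric_values act (yvar j)))"

definition ln_mult :: "ln \<Rightarrow> ln \<Rightarrow> ln" where
  "ln_mult s t =
     (THE r. \<forall>N. \<forall>p\<in>poly_ring N. poly_act r p = poly_act s (poly_act t p))"

definition milnor_module :: "(ln \<Rightarrow> 'a \<Rightarrow> 'a::comm_ring_1) \<Rightarrow> bool" where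
  "milnor_module act \<longleftrightarrow>
     cartan_action act \<and> (\<forall>s t u. act (ln_mult s t) u = act s (act t u))"


section \<open>The dual algebra\<close>

text \<open>
  There are finitely many collections of each degree, so an element of the graded dual is a
  finitely supported family of integers, its values on the basis \<^const>\<open>s_op\<close>. The library
  product \<open>*\<close> on this type is convolution, which is dual to \<^const>\<open>coproduct\<close>
  (lemma \<open>pairing_mult\<close>), and the ring is the polynomial ring in the \<open>s_star k\<close>,
  with the collections as exponents of the monomials (lemma \<open>prod_s_star\<close>).
\<close>

type_synonym ln_dual = "collection \<Rightarrow>\<^sub>0 int"

definition pairing :: "ln_dual \<Rightarrow> ln \<Rightarrow> int" where
  "pairing l s = (\<Sum>w\<in>Poly_Mapping.keys s. Poly_Mapping.lookup l w * Poly_Mapping.lookup s w)"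

definition s_star :: "num \<Rightarrow> ln_dual" where
  "s_star k = Poly_Mapping.single {#k#} 1"

lemma pairing_s_op: "pairing l (s_op w) = Poly_Mapping.lookup l w"
  by (simp add: pairing_def s_op_def)

lemma pairing_s_star: "pairing (s_star k) (s_op w) = (if w = {#k#} then 1 else 0)"
  by (auto simp: pairing_s_op s_star_def lookup_single when_def)

lemma pairing_mult:
  fixes l m :: ln_dual
  shows "pairing (l * m) (s_op w) =
    (\<Sum>(w', w'')\<in>splittings w. pairing l (s_op w') * pairing m (s_op w''))"
proof -
  have "Poly_Mapping.lookup (l * m) w =
      (\<Sum>(a, b). Poly_Mapping.lookup l a * Poly_Mapping.lookup m b when w = a + b)"
    by transfer (simp add: prod_fun_unfold_prod)
  also have "\<dots> = (\<Sum>(a, b)\<in>splittings w.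
      Poly_Mapping.lookup l a * Poly_Mapping.lookup m b when w = a + b)"
    by (rule Sum_any.expand_superset) (auto simp: finite_splittings, auto simp: splittings_def)
  also have "\<dots> = (\<Sum>(a, b)\<in>splittings w. Poly_Mapping.lookup l a * Poly_Mapping.lookup m b)"
    by (rule sum.cong) (auto simp: splittings_def)
  finally show ?thesis
    by (simp add: pairing_s_op)
qed

lemma prod_s_star: "(\<Prod>k\<in>#w. s_star k) = Poly_Mapping.single w 1"
  by (induction w) (simp_all add: s_star_def mult_single)

definition Rstar :: "ln \<Rightarrow> ln_dual \<Rightarrow> ln_dual" where
  "Rstar s l = (THE m. \<forall>s'. pairing m s' = pairing l (ln_mult s' s))"

definition dual_homogeneous :: "int \<Rightarrow> ln_dual \<Rightarrow> bool" where
  "dual_homogeneous d l \<longleftrightarrow> (\<forall>w\<in>Poly_Mapping.keys l. - int (deg w) = d)"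


section \<open>Power series in two variables over the dual\<close>

text \<open>
  Power series in \<open>x1, x2\<close> are power series in \<open>x2\<close> over power series in \<open>x1\<close>; the coefficient
  of \<open>x1 ^ i * x2 ^ j\<close> in \<open>f\<close> is \<open>f $ j $ i\<close>.
\<close>

type_synonym dual_series = "ln_dual fps fps"

definition const_series :: "ln_dual \<Rightarrow> dual_series" where
  "const_series l = fps_const (fps_const l)"

definition x1 :: dual_series where
  "x1 = fps_const fps_X"

definition x2 :: dual_series where
  "x2 = fps_X"

definition series2 :: "(nat \<Rightarrow> nat \<Rightarrow> ln_dual) \<Rightarrow> dual_series" where
  "series2 a = Abs_fps (\<lambda>j. Abs_fps (\<lambda>i. a i j))"

lemma nth_monomial:
  "fps_nth (fps_nth (const_series l * x1 ^ i * x2 ^ j) n) m = (if m = i \<and> n = j then l else 0)"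
  by (simp add: const_series_def x1_def x2_def fps_const_power fps_X_power_mult_right_nth
      fps_X_power_nth mult.assoc)

definition series_homogeneous :: "int \<Rightarrow> dual_series \<Rightarrow> bool" where
  "series_homogeneous d f \<longleftrightarrow>
     (\<forall>i j. dual_homogeneous (d - 2 * int i - 2 * int j) (fps_nth (fps_nth f j) i))"

text \<open>
  No continuity has to be required for uniqueness: the Cartan formula forces the operations to
  preserve the powers of the ideal generated by \<^const>\<open>x1\<close> and \<^const>\<open>x2\<close>.
\<close>

definition series_act :: "ln \<Rightarrow> dual_series \<Rightarrow> dual_series" where
  "series_act = (THE act. milnor_module act \<and>
     (\<forall>s l. act s (const_series l) = const_series (Rstar s l)) \<and>
     geometric_values act x1 \<and> geometric_values act x2)"

definition geometric_cobordism :: "dual_series \<Rightarrow> bool" where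
  "geometric_cobordism x \<longleftrightarrow> series_homogeneous 2 x \<and> geometric_values series_act x"

end

theory Submission imports Defs begin

text \<open>
  An action with the Cartan formula is the same as a ring homomorphism \<open>u \<mapsto> \<Sum> s\<^sub>w(u) b\<^sup>w\<close> into power
  series in variables \<open>b\<^sub>1, b\<^sub>2, \<dots>\<close>; an element \<open>x\<close> is geometric iff it goes to
  \<open>\<beta>(x) = x + \<Sum> b\<^sub>k x\<^sup>k\<^sup>+\<^sup>1\<close>. The product is therefore dual to composition of such series, and on
  \<open>S\<^sup>*\<close> the operations send the coefficients of \<open>\<alpha>(y) = y + \<Sum> s\<^sub>k\<^sup>* y\<^sup>k\<^sup>+\<^sup>1\<close> to those of \<open>\<beta>(\<alpha>(y))\<close>.
  So if the operations act on coefficients only, \<open>\<alpha>(y)\<close> is geometric, and in the coordinates \<open>y\<^sub>i\<close>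
  with \<open>x\<^sub>i = \<alpha>(y\<^sub>i)\<close> the Milnor module \<open>S\<^sup>*[[x\<^sub>1,x\<^sub>2]]\<close> is \<open>S\<^sup>*[[y\<^sub>1,y\<^sub>2]]\<close> with the coefficientwise
  action. There \<open>\<alpha>(y\<^sub>1 + y\<^sub>2)\<close> is geometric. Conversely a geometric series is \<open>\<alpha>\<close> of its reduction
  along the counit of \<open>S\<^sup>*\<close>, and homogeneity of degree 2 forces this reduction to be \<open>y\<^sub>1 + y\<^sub>2\<close>.
\<close>

unbundle fps_syntax

section \<open>Series in the variables b_k, ring homomorphisms and linear extension\<close>

section \<open>Power series indexed by collections\<close>

text \<open>The entry at \<open>w\<close> is the coefficient of the monomial b^w, with one variable
  b_k for each k. Adding collections multiplies monomials, and a collection has finitely many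
  splittings, so arbitrary functions can be convolved.\<close>

typedef 'a mps = "UNIV :: (collection \<Rightarrow> 'a) set"
  morphisms mps_nth Abs_mps ..

setup_lifting type_definition_mps

notation mps_nth (infixl \<open>$$\<close> 75)

lemma mps_nth_Abs [simp]: "Abs_mps f $$ w = f w"
  by (simp add: Abs_mps_inverse)

lemma mps_eqI: "(\<And>w. f $$ w = g $$ w) \<Longrightarrow> f = g"
  by (metis ext mps_nth_inject)

lemma mps_eq_iff: "f = g \<longleftrightarrow> (\<forall>w. f $$ w = g $$ w)"
  by (auto intro: mps_eqI)

lemma splittings_iff: "(a, b) \<in> splittings w \<longleftrightarrow> a + b = w"
  by (simp add: splittings_def)

lemma splittings_empty: "splittings {#} = {({#}, {#})}"
  by (auto simp: splittings_def)

lemma sum_splittings_swap: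
  "(\<Sum>(a, b)\<in>splittings w. g a b) = (\<Sum>(a, b)\<in>splittings w. g b a)"
  by (rule sum.reindex_bij_witness[of _ prod.swap prod.swap])
     (auto simp: splittings_def add.commute)

lemma sum_splittings_assoc:
  fixes g :: "collection \<Rightarrow> collection \<Rightarrow> collection \<Rightarrow> 'a::comm_monoid_add"
  shows "(\<Sum>(p, c)\<in>splittings w. \<Sum>(a, b)\<in>splittings p. g a b c) =
         (\<Sum>(a, q)\<in>splittings w. \<Sum>(b, c)\<in>splittings q. g a b c)"
proof -
  have "(\<Sum>(p, c)\<in>splittings w. \<Sum>(a, b)\<in>splittings p. g a b c) =
        (\<Sum>((p, c), (a, b))\<in>Sigma (splittings w) (\<lambda>(p, c). splittings p). g a b c)"
    by (subst sum.Sigma[symmetric]) (auto simp: finite_splittings split_def)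
  also have "\<dots> = (\<Sum>((a, q), (b, c))\<in>Sigma (splittings w) (\<lambda>(a, q). splittings q). g a b c)"
    by (rule sum.reindex_bij_witness
        [of _ "\<lambda>((a, q), (b, c)). ((a + b, c), (a, b))" "\<lambda>((p, c), (a, b)). ((a, b + c), (b, c))"])
       (auto simp: splittings_def add.assoc)
  also have "\<dots> = (\<Sum>(a, q)\<in>splittings w. \<Sum>(b, c)\<in>splittings q. g a b c)"
    by (subst sum.Sigma[symmetric]) (auto simp: finite_splittings split_def)
  finally show ?thesis .
qed

lemma sum_splittings_empty_left:
  "(\<Sum>(a, b)\<in>splittings w. if a = {#} then g b else (0::'a::comm_monoid_add)) = g w"
proof -
  have "(\<Sum>(a, b)\<in>splittings w. if a = {#} then g b else 0) =
        (\<Sum>(a, b)\<in>{({#} :: collection, w)}. if a = {#} then g b else 0)"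
    by (rule sum.mono_neutral_right[OF finite_splittings]) (auto simp: splittings_def split: if_splits)
  then show ?thesis by simp
qed

instantiation mps :: (comm_ring_1) comm_ring_1
begin

lift_definition zero_mps :: "'a mps" is "\<lambda>_. 0" .
lift_definition one_mps :: "'a mps" is "\<lambda>w. if w = {#} then 1 else 0" .
lift_definition plus_mps :: "'a mps \<Rightarrow> 'a mps \<Rightarrow> 'a mps" is "\<lambda>f g w. f w + g w" .
lift_definition minus_mps :: "'a mps \<Rightarrow> 'a mps \<Rightarrow> 'a mps" is "\<lambda>f g w. f w - g w" .
lift_definition uminus_mps :: "'a mps \<Rightarrow> 'a mps" is "\<lambda>f w. - f w" .
lift_definition times_mps :: "'a mps \<Rightarrow> 'a mps \<Rightarrow> 'a mps"
  is "\<lambda>f g w. \<Sum>(a, b)\<in>splittings w. f a * g b" .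

instance
proof
  fix f g h :: "'a mps"
  show "f * g * h = f * (g * h)"
  proof (transfer, rule ext)
    fix f g h :: "collection \<Rightarrow> 'a" and w
    show "(\<Sum>(p, c)\<in>splittings w. (\<Sum>(a, b)\<in>splittings p. f a * g b) * h c) =
          (\<Sum>(a, q)\<in>splittings w. f a * (\<Sum>(b, c)\<in>splittings q. g b * h c))"
      using sum_splittings_assoc[of "\<lambda>a b c. f a * g b * h c" w]
      by (simp add: sum_distrib_left sum_distrib_right split_def mult.assoc)
  qed
  show "f * g = g * f"
    by (transfer, rule ext, subst sum_splittings_swap) (simp add: mult.commute)
  show "1 * f = f"
  proof (transfer, rule ext)
    fix f :: "collection \<Rightarrow> 'a" and w
    have "(\<Sum>(a, b)\<in>splittings w. (if a = {#} then 1 else 0) * f b) =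
          (\<Sum>(a, b)\<in>splittings w. if a = {#} then f b else 0)"
      by (rule sum.cong) auto
    then show "(\<Sum>(a, b)\<in>splittings w. (if a = {#} then 1 else 0) * f b) = f w"
      by (simp add: sum_splittings_empty_left)
  qed
  show "(f + g) * h = f * h + g * h"
    by transfer (simp add: distrib_right sum.distrib split_def)
  show "(0::'a mps) \<noteq> 1"
    by transfer (metis zero_neq_one)
  show "f + g + h = f + (g + h)" "f + g = g + f" "0 + f = f" "- f + f = 0" "f - g = f + - g"
    by (transfer; simp add: algebra_simps)+
qed

end

lemma mps_nth_zero [simp]: "0 $$ w = 0" by transfer simp
lemma mps_nth_one: "1 $$ w = (if w = {#} then 1 else 0)" by transfer simp
lemma mps_nth_add [simp]: "(f + g) $$ w = f $$ w + g $$ w" by transfer simp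
lemma mps_nth_diff [simp]: "(f - g) $$ w = f $$ w - g $$ w" by transfer simp
lemma mps_nth_mult: "(f * g) $$ w = (\<Sum>(a, b)\<in>splittings w. f $$ a * g $$ b)"
  by transfer simp
lemma mps_nth_mult_empty: "(f * g) $$ {#} = f $$ {#} * g $$ {#}"
  by (simp add: mps_nth_mult splittings_empty)

text \<open>In the convolution for \<open>z * z\<close> at \<open>w\<close>, either the second
  factor sits at the empty collection, where \<open>z\<close> vanishes, or the first sits at a
  smaller collection, where induction applies. This is how the Cartan formula yields that total
  operations preserve 1.\<close>

lemma mps_idempotent_eq_0:
  assumes "z * z = z" "z $$ {#} = 0"
  shows "z = 0"
proof (rule mps_eqI)
  show "z $$ w = 0 $$ w" for w
  proof (induction "size w" arbitrary: w rule: less_induct)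
    case less
    have "z $$ a * z $$ b = 0" if "a + b = w" for a b
    proof (cases "b = {#}")
      case False
      then have "size a < size w" using that by (auto simp: nonempty_has_size)
      then show ?thesis using less by simp
    qed (use assms in simp)
    then have "(z * z) $$ w = 0"
      unfolding mps_nth_mult by (intro sum.neutral) (auto simp: splittings_def)
    then show ?case using assms by simp
  qed
qed

section \<open>Ring homomorphisms\<close>

locale ring_hom = additive f for f :: "'a::comm_ring_1 \<Rightarrow> 'b::comm_ring_1" +
  assumes one: "f 1 = 1" and mult: "f (x * y) = f x * f y"
begin

lemma power: "f (x ^ n) = f x ^ n"
  by (induction n) (simp_all add: one mult)

end

lemma ring_hom_comp: "ring_hom f \<Longrightarrow> ring_hom g \<Longrightarrow> ring_hom (\<lambda>x. f (g x))"
  by (simp add: ring_hom_def ring_hom_axioms_def additive_def)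

lemma ring_hom_inverse:
  assumes "ring_hom f" "\<And>x. g (f x) = x" "\<And>y. f (g y) = y"
  shows "ring_hom g"
proof -
  interpret ring_hom f by fact
  show ?thesis
  proof
    show "g (x + y) = g x + g y" for x y using assms(2)[of "g x + g y"] by (simp add: add assms(3))
    show "g (x * y) = g x * g y" for x y using assms(2)[of "g x * g y"] by (simp add: mult assms(3))
    show "g 1 = 1" using assms(2)[of 1] by (simp add: one)
  qed
qed

definition mps_map :: "('a \<Rightarrow> 'b) \<Rightarrow> 'a mps \<Rightarrow> 'b mps" where
  "mps_map h f = Abs_mps (\<lambda>w. h (f $$ w))"

lemma mps_nth_map [simp]: "mps_map h f $$ w = h (f $$ w)"
  by (simp add: mps_map_def)

lemma ring_hom_mps_map:
  assumes "ring_hom h" shows "ring_hom (mps_map h)"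
proof -
  interpret ring_hom h by fact
  show ?thesis
    by standard (auto intro!: mps_eqI sum.cong simp: add one zero mps_nth_one mps_nth_mult sum mult)
qed

lemma ring_hom_mps_nth_empty: "ring_hom (\<lambda>f :: 'a::comm_ring_1 mps. f $$ {#})"
  by standard (simp_all add: mps_nth_one mps_nth_mult_empty)

section \<open>Additive maps on free abelian groups\<close>

lemma additive_eq_on_frag:
  fixes f g :: "('k \<Rightarrow>\<^sub>0 int) \<Rightarrow> 'b::ab_group_add"
  assumes "additive f" "additive g"
    and "\<And>k. f (Poly_Mapping.single k 1) = g (Poly_Mapping.single k 1)"
  shows "f s = g s"
proof -
  interpret f: additive f by fact
  interpret g: additive g by fact
  show ?thesis
    using subset_UNIV
    by (induction s rule: frag_induction)
       (simp_all add: f.zero g.zero f.diff g.diff assms(3))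
qed

text \<open>The keys may be collections or exponents of monomials, so the same extension serves for
  functionals on \<open>ln\<close>, for evaluation of polynomials and for substitution into elements
  of the dual.\<close>

definition lin :: "('k \<Rightarrow> 'a::comm_ring_1) \<Rightarrow> ('k \<Rightarrow>\<^sub>0 int) \<Rightarrow> 'a" where
  "lin \<phi> s = (\<Sum>k\<in>Poly_Mapping.keys s. of_int (Poly_Mapping.lookup s k) * \<phi> k)"

lemma lin_superset:
  assumes "finite K" "Poly_Mapping.keys s \<subseteq> K"
  shows "lin \<phi> s = (\<Sum>k\<in>K. of_int (Poly_Mapping.lookup s k) * \<phi> k)"
  unfolding lin_def using assms
  by (intro sum.mono_neutral_left) (auto simp: in_keys_iff)

lemma additive_lin:
  fixes \<phi> :: "'k \<Rightarrow> 'a::comm_ring_1"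
  shows "additive (lin \<phi>)"
proof
  fix s t :: "'k \<Rightarrow>\<^sub>0 int"
  let ?K = "Poly_Mapping.keys s \<union> Poly_Mapping.keys t"
  have "lin \<phi> (s + t) = (\<Sum>k\<in>?K. of_int (Poly_Mapping.lookup (s + t) k) * \<phi> k)"
    by (rule lin_superset) (auto dest: subsetD[OF keys_add])
  also have "\<dots> = lin \<phi> s + lin \<phi> t"
    by (simp add: lin_superset[of ?K] lookup_add distrib_right sum.distrib)
  finally show "lin \<phi> (s + t) = lin \<phi> s + lin \<phi> t" .
qed

lemma lin_single [simp]: "lin \<phi> (Poly_Mapping.single k n) = of_int n * \<phi> k"
  by (simp add: lin_def)

lemma lin_one [simp]: "lin \<phi> 1 = \<phi> 0"
  by (simp flip: single_one)

lemma lin_s_op [simp]: "lin \<phi> (s_op w) = \<phi> w"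
  by (simp add: s_op_def)

lemma lin_add: "lin \<phi> (s + t) = lin \<phi> s + lin \<phi> t"
  using additive_lin additive.add by blast

lemma lin_sum: "lin \<phi> (sum g A) = (\<Sum>a\<in>A. lin \<phi> (g a))"
  using additive_lin additive.sum by blast

text \<open>Universal property of the monoid ring: additivity in each factor reduces
  multiplicativity to basis elements.\<close>

lemma ring_hom_lin:
  fixes \<phi> :: "'m::comm_monoid_add \<Rightarrow> 'a::comm_ring_1"
  assumes "\<phi> 0 = 1" "\<And>m n. \<phi> (m + n) = \<phi> m * \<phi> n"
  shows "ring_hom (lin \<phi>)"
proof -
  interpret additive "lin \<phi>" by (rule additive_lin)
  show ?thesis
  proof
    show "lin \<phi> 1 = 1"
      using assms(1) by (simp flip: single_one)
    show "lin \<phi> (p * q) = lin \<phi> p * lin \<phi> q" for p q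
    proof (rule additive_eq_on_frag[where f = "\<lambda>p. lin \<phi> (p * q)"])
      fix m
      show "lin \<phi> (Poly_Mapping.single m 1 * q) = lin \<phi> (Poly_Mapping.single m 1) * lin \<phi> q"
        by (rule additive_eq_on_frag[where f = "\<lambda>q. lin \<phi> (Poly_Mapping.single m 1 * q)"])
           (auto intro!: additive.intro simp: distrib_left distrib_right add mult_single assms(2))
    qed (auto intro!: additive.intro simp: distrib_left distrib_right add)
  qed
qed

section \<open>Actions as ring homomorphisms, and the action on polynomials\<close>

section \<open>Actions and total operations\<close>

definition total_op :: "(ln \<Rightarrow> 'a \<Rightarrow> 'a) \<Rightarrow> 'a \<Rightarrow> 'a mps" where
  "total_op act u = Abs_mps (\<lambda>w. act (s_op w) u)"

lemma total_op_nth [simp]: "total_op act u $$ w = act (s_op w) u"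
  by (simp add: total_op_def)

lemma cartan_action_additive:
  assumes "cartan_action act"
  shows "additive (act s)" "additive (\<lambda>s. act s u)"
  using assms by (simp_all add: cartan_action_def additive_def)

lemma cartan_action_eq_lin:
  fixes act :: "ln \<Rightarrow> 'a::comm_ring_1 \<Rightarrow> 'a"
  assumes "cartan_action act"
  shows "act s u = lin (\<lambda>w. act (s_op w) u) s"
  by (rule additive_eq_on_frag[where f = "\<lambda>s. act s u"])
     (use assms in \<open>simp_all add: cartan_action_additive additive_lin flip: s_op_def\<close>)

lemma ring_hom_total_op:
  fixes act :: "ln \<Rightarrow> 'a::comm_ring_1 \<Rightarrow> 'a"
  assumes "cartan_action act"
  shows "ring_hom (total_op act)"
proof -
  have mult: "total_op act (u * v) = total_op act u * total_op act v" for u v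
  proof (rule mps_eqI)
    fix w
    \<comment> \<open>\<open>cartan_action\<close> speaks of lists of tensors, so the splittings are
      enumerated without repetition.\<close>
    obtain xs where xs: "set xs = splittings w" "distinct xs"
      using finite_distinct_list[OF finite_splittings] by blast
    have "coproduct (s_op w) = (\<Sum>(s', s'')\<leftarrow>map (\<lambda>(a, b). (s_op a, s_op b)) xs. tensor s' s'')"
      by (simp add: coproduct_s_op split_def comp_def sum_list_distinct_conv_sum_set xs flip: xs(1))
    then have "act (s_op w) (u * v) =
        (\<Sum>(s', s'')\<leftarrow>map (\<lambda>(a, b). (s_op a, s_op b)) xs. act s' u * act s'' v)"
      using assms unfolding cartan_action_def by blast
    also have "\<dots> = (\<Sum>(a, b)\<in>splittings w. act (s_op a) u * act (s_op b) v)"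
      by (simp add: split_def comp_def sum_list_distinct_conv_sum_set xs flip: xs(1))
    finally show "total_op act (u * v) $$ w = (total_op act u * total_op act v) $$ w"
      by (simp add: mps_nth_mult)
  qed
  \<comment> \<open>\<open>1 - total_op act 1\<close> is an idempotent without constant term, hence zero.\<close>
  have "1 - total_op act 1 = 0"
  proof (rule mps_idempotent_eq_0)
    show "(1 - total_op act 1) * (1 - total_op act 1) = 1 - total_op act 1"
      using mult[of 1 1] by (simp add: algebra_simps)
    show "(1 - total_op act 1) $$ {#} = 0"
      using assms by (simp add: mps_nth_one cartan_action_def)
  qed
  then have one: "total_op act 1 = 1" by simp
  show ?thesis
    by standard (use assms in \<open>auto simp: one mult cartan_action_def intro: mps_eqI\<close>)
qed

lemma cartan_actionI:
  fixes act :: "ln \<Rightarrow> 'a::comm_ring_1 \<Rightarrow> 'a"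
  assumes hom: "ring_hom (total_op act)" and unit: "\<And>u. act (s_op {#}) u = u"
    and add: "\<And>s t u. act (s + t) u = act s u + act t u"
  shows "cartan_action act"
proof -
  have lin: "act s u = lin (\<lambda>w. total_op act u $$ w) s" for s u
    by (rule additive_eq_on_frag[where f = "\<lambda>s. act s u"])
       (simp_all add: additive_lin additive_def[of "\<lambda>s. act s u"] add flip: s_op_def)
  have add_right: "act s (u + v) = act s u + act s v" for s u v
    unfolding lin[of s u] lin[of s v] lin[of s "u + v"]
    by (simp add: additive.add[OF ring_hom.axioms(1)[OF hom]] lin_def distrib_left sum.distrib del: total_op_nth)
  have cartan: "act s (u * v) = (\<Sum>(s', s'')\<leftarrow>ps. act s' u * act s'' v)"
    if ps: "coproduct s = (\<Sum>(s', s'')\<leftarrow>ps. tensor s' s'')" for s u v ps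
  proof -
    \<comment> \<open>\<open>B\<close> is an additive map on the tensor square, so its value at the
      coproduct can be computed both from the given list \<open>ps\<close> and from the
      splittings.\<close>
    define B where "B = lin (\<lambda>(a, b). act (s_op a) u * act (s_op b) v)"
    interpret B: additive B unfolding B_def by (rule additive_lin)
    have "B (tensor s' s'') = act s' u * act s'' v" for s' s''
    proof -
      have "B (tensor s' s'') = (\<Sum>a\<in>Poly_Mapping.keys s'. \<Sum>b\<in>Poly_Mapping.keys s''.
          of_int (Poly_Mapping.lookup s' a * Poly_Mapping.lookup s'' b) *
          (act (s_op a) u * act (s_op b) v))"
        unfolding tensor_def B.sum by (intro sum.cong refl) (simp add: B_def)
      also have "\<dots> = lin (\<lambda>w. total_op act u $$ w) s' * lin (\<lambda>w. total_op act v $$ w) s''"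
        unfolding lin_def sum_product by (intro sum.cong refl) (simp add: mult_ac)
      finally show ?thesis by (simp only: lin[of s' u] lin[of s'' v])
    qed
    moreover have "B (sum_list ts) = (\<Sum>t\<leftarrow>ts. B t)" for ts
      by (induction ts) (simp_all add: B.zero B.add)
    ultimately have "B (coproduct s) = (\<Sum>(s', s'')\<leftarrow>ps. act s' u * act s'' v)"
      by (simp add: ps split_def comp_def)
    moreover have "B (coproduct s) = act s (u * v)"
    proof -
      have "B (coproduct s) = (\<Sum>w\<in>Poly_Mapping.keys s. of_int (Poly_Mapping.lookup s w) *
          (\<Sum>(a, b)\<in>splittings w. act (s_op a) u * act (s_op b) v))"
        unfolding coproduct_def B.sum split_def sum_distrib_left
        by (intro sum.cong refl) (simp add: B_def split_def)
      also have "\<dots> = lin (\<lambda>w. (total_op act u * total_op act v) $$ w) s"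
        by (simp add: lin_def mps_nth_mult)
      finally show ?thesis
        by (simp only: lin[of s] ring_hom.mult[OF hom])
    qed
    ultimately show ?thesis by simp
  qed
  show ?thesis
    unfolding cartan_action_def using unit add add_right cartan by blast
qed

text \<open>Converse to \<open>ring_hom_total_op\<close>, and the means of constructing actions: the
  coefficients of \<open>T u\<close> prescribe the basis operations, and the constant term makes the
  unit act as the identity.\<close>

lemma cartan_action_lin:
  fixes T :: "'a::comm_ring_1 \<Rightarrow> 'a mps"
  assumes "ring_hom T" "\<And>u. T u $$ {#} = u"
  shows "cartan_action (\<lambda>s u. lin (mps_nth (T u)) s)"
proof (rule cartan_actionI)
  have "total_op (\<lambda>s u. lin (mps_nth (T u)) s) = T"
    by (intro ext mps_eqI) (simp add: s_op_def)
  then show "ring_hom (total_op (\<lambda>s u. lin (mps_nth (T u)) s))"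
    using assms(1) by simp
qed (simp_all add: assms(2) lin_add)

definition wt :: "collection \<Rightarrow> nat" where
  "wt w = (\<Sum>k\<in>#w. nat_of_num k)"

lemma wt_simps [simp]: "wt {#} = 0" "wt (add_mset k w) = nat_of_num k + wt w" "wt (a + b) = wt a + wt b"
  by (simp_all add: wt_def)

text \<open>The empty collection is admitted: its value is \<open>x\<close> itself, in accordance with weight \<open>0\<close>.\<close>

definition geom :: "'a::comm_ring_1 \<Rightarrow> 'a mps" where
  "geom x = Abs_mps (\<lambda>w. if size w \<le> 1 then x ^ (wt w + 1) else 0)"

lemma geom_nth: "geom x $$ w = (if size w \<le> 1 then x ^ (wt w + 1) else 0)"
  by (simp add: geom_def)

lemma geometric_values_iff:
  fixes act :: "ln \<Rightarrow> 'a::comm_ring_1 \<Rightarrow> 'a"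
  assumes unit: "\<And>u. act (s_op {#}) u = u"
  shows "geometric_values act x \<longleftrightarrow> total_op act x = geom x"
proof
  assume g: "geometric_values act x"
  then have g1: "act (s_op {#k#}) x = x ^ (nat_of_num k + 1)" for k
    unfolding geometric_values_def by blast
  from g have g2: "act (s_op w) x = 0" if "size w > 1" for w
    using that unfolding geometric_values_def by blast
  show "total_op act x = geom x"
  proof (rule mps_eqI)
    fix w
    show "total_op act x $$ w = geom x $$ w"
    proof (cases w)
      case empty
      then show ?thesis by (simp add: geom_nth unit)
    next
      case (add k v)
      show ?thesis
      proof (cases "v = {#}")
        case True
        then show ?thesis by (simp add: add geom_nth g1 del: power_Suc)
      next
        case False
        then have "size w > 1" by (cases v) (simp_all add: add)
        then show ?thesis by (simp add: geom_nth g2)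
      qed
    qed
  qed
next
  assume t: "total_op act x = geom x"
  have "act (s_op w) x = geom x $$ w" for w
    unfolding t[symmetric] by (rule total_op_nth[symmetric])
  then show "geometric_values act x"
    unfolding geometric_values_def by (auto simp add: geom_nth)
qed

lemma cartan_action_eqI:
  fixes act act' :: "ln \<Rightarrow> 'a::comm_ring_1 \<Rightarrow> 'a"
  assumes "cartan_action act" "cartan_action act'" "\<And>u. total_op act u = total_op act' u"
  shows "act = act'"
proof (intro ext)
  fix s u
  have "act (s_op w) u = act' (s_op w) u" for w
    using arg_cong[OF assms(3)[of u], of "\<lambda>f. f $$ w"] by simp
  then show "act s u = act' s u"
    by (simp add: cartan_action_eq_lin[OF assms(1), of s] cartan_action_eq_lin[OF assms(2), of s])
qed

section \<open>The action on polynomial rings\<close>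

lemma yvar_power: "yvar j ^ e = Poly_Mapping.single (Poly_Mapping.single j e) 1"
  by (induction e) (simp_all add: yvar_def mult_single flip: single_add)

lemma int_mpoly_induct [case_names one yvar diff mult]:
  assumes "P 1" "\<And>j. P (yvar j)" "\<And>p q. P p \<Longrightarrow> P q \<Longrightarrow> P (p - q)"
    "\<And>p q. P p \<Longrightarrow> P q \<Longrightarrow> P (p * q)"
  shows "P p"
proof -
  have pow: "P (yvar j ^ e)" for j e
    by (induction e) (use assms in auto)
  have "P (Poly_Mapping.single m 1)" for m
  proof (induction m rule: update_induct)
    case const
    then show ?case using assms(1) by simp
  next
    case (update f a b)
    have "Poly_Mapping.update a b f = f + Poly_Mapping.single a b"
      using update(1)
      by (intro poly_mapping_eqI) (auto simp: lookup_update lookup_add lookup_single when_def in_keys_iff)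
    then have "Poly_Mapping.single (Poly_Mapping.update a b f) 1 =
        Poly_Mapping.single f 1 * yvar a ^ b"
      by (simp add: yvar_power mult_single)
    then show ?case using update(3) pow assms(4) by metis
  qed
  moreover have "P 0" using assms(3)[OF assms(1) assms(1)] by simp
  ultimately show ?thesis
    using assms(3) by - (rule frag_induction[OF subset_UNIV, of P])
qed

lemma ring_hom_eq_on_mpoly:
  assumes "ring_hom f" "ring_hom g" "\<And>j. f (yvar j) = g (yvar j)"
  shows "f p = g p"
proof -
  interpret f: ring_hom f by fact
  interpret g: ring_hom g by fact
  show ?thesis
    by (induction p rule: int_mpoly_induct)
       (simp_all add: f.one g.one f.diff g.diff f.mult g.mult assms(3))
qed

definition mpoly_eval :: "(nat \<Rightarrow> 'a::comm_ring_1) \<Rightarrow> int_mpoly \<Rightarrow> 'a" where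
  "mpoly_eval g = lin (\<lambda>m. \<Prod>j. g j ^ Poly_Mapping.lookup m j)"

lemma ring_hom_mpoly_eval: "ring_hom (mpoly_eval g)"
  unfolding mpoly_eval_def
proof (rule ring_hom_lin)
  have fin: "finite {j. g j ^ Poly_Mapping.lookup m j \<noteq> 1}" for m
    by (rule finite_subset[of _ "Poly_Mapping.keys m"]) (auto simp: in_keys_iff intro: ccontr)
  show "(\<Prod>j. g j ^ Poly_Mapping.lookup (m + n) j) =
      (\<Prod>j. g j ^ Poly_Mapping.lookup m j) * (\<Prod>j. g j ^ Poly_Mapping.lookup n j)" for m n
    by (simp add: lookup_add power_add Prod_any.distrib fin)
qed simp

lemma mpoly_eval_yvar: "mpoly_eval g (yvar j) = g j"
proof -
  have "(\<Prod>i. g i ^ Poly_Mapping.lookup (Poly_Mapping.single j 1) i) =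
      (\<Prod>i\<in>{j}. g i ^ Poly_Mapping.lookup (Poly_Mapping.single j 1) i)"
    by (rule Prod_any.expand_superset) (auto simp: lookup_single when_def intro: ccontr)
  then show ?thesis by (simp add: mpoly_eval_def yvar_def)
qed

text \<open>Evaluating a polynomial at the series \<open>geom (yvar j)\<close> produces such an
  action. Any other has a total operation that agrees with it on the variables, hence everywhere; so
  the description in \<open>poly_act\<close> is met by exactly one action.\<close>

lemma
  shows cartan_action_poly_act: "cartan_action poly_act"
    and total_op_poly_act_yvar: "total_op poly_act (yvar j) = geom (yvar j)"
proof -
  let ?P = "\<lambda>act. cartan_action act \<and> (\<forall>j. geometric_values act (yvar j))"
  define T where "T = mpoly_eval (\<lambda>j. geom (yvar j))"
  define act where "act = (\<lambda>s u. lin (mps_nth (T u)) s)"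
  have T: "ring_hom T" "T (yvar j) = geom (yvar j)" for j
    by (simp_all add: T_def ring_hom_mpoly_eval mpoly_eval_yvar)
  have unit: "T u $$ {#} = u" for u
    by (rule ring_hom_eq_on_mpoly[where f = "\<lambda>u. T u $$ {#}"])
       (auto simp: T geom_nth ring_hom_comp[OF ring_hom_mps_nth_empty T(1)] ring_hom_def
          ring_hom_axioms_def additive_def)
  have act: "cartan_action act"
    unfolding act_def using T(1) unit by (rule cartan_action_lin)
  have total_act: "total_op act = T"
    by (intro ext mps_eqI) (simp add: act_def)
  have geom_iff: "geometric_values a x \<longleftrightarrow> total_op a x = geom x"
    if "cartan_action a" for a and x :: int_mpoly
    using that by (intro geometric_values_iff) (simp add: cartan_action_def)
  have "\<exists>!act. ?P act"
  proof
    show "?P act"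
      using act by (simp add: geom_iff total_act T)
    fix act' assume act': "?P act'"
    show "act' = act"
    proof (rule cartan_action_eqI)
      show "cartan_action act'" using act' by blast
      have act'_yvar: "total_op act' (yvar j) = geom (yvar j)" for j
        using act' geom_iff by blast
      show "total_op act' u = total_op act u" for u
        by (rule ring_hom_eq_on_mpoly) (use act' act act'_yvar T in \<open>auto simp: ring_hom_total_op total_act\<close>)
    qed (rule act)
  qed
  then have "?P poly_act"
    unfolding poly_act_def by (rule theI')
  then have "cartan_action poly_act" "geometric_values poly_act (yvar j)"
    by blast+
  then show "cartan_action poly_act" "total_op poly_act (yvar j) = geom (yvar j)"
    by (simp_all only: geom_iff)
qed

section \<open>Composition of series and the structure constants\<close>

section \<open>Structure constants\<close>

lemma wt_eq_0_iff [simp]: "wt w = 0 \<longleftrightarrow> w = {#}"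
proof
  show "w = {#}" if "wt w = 0"
  proof (cases w)
    case (add k v)
    then show ?thesis using that nat_of_num_pos[of k] by simp
  qed
qed simp

lemma size_le_wt: "size w \<le> wt w"
proof (induction w)
  case (add k w)
  then show ?case using nat_of_num_pos[of k] by simp
qed simp

text \<open>Such a collection has at most n entries, each at most n. All sums over collections of
  bounded weight rest on this.\<close>

lemma finite_wt_le: "finite {v. wt v \<le> n}"
proof -
  have "finite {k. nat_of_num k \<le> n}"
    by (rule inj_on_finite[of nat_of_num _ "{..n}"]) (auto intro: inj_onI simp: num_eq_iff)
  then have "finite {xs. set xs \<subseteq> {k. nat_of_num k \<le> n} \<and> length xs \<le> n}"
    by (rule finite_lists_length_le)
  moreover have "{v. wt v \<le> n} \<subseteq> mset ` {xs. set xs \<subseteq> {k. nat_of_num k \<le> n} \<and> length xs \<le> n}"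
  proof
    fix v assume "v \<in> {v. wt v \<le> n}"
    then have v: "wt v \<le> n" by simp
    obtain xs where xs: "mset xs = v" using ex_mset by blast
    have "nat_of_num k \<le> n" if "k \<in># v" for k
      using v that by (auto dest!: multi_member_split)
    moreover have "length xs \<le> n"
      using size_le_wt[of v] v xs by auto
    ultimately show "v \<in> mset ` {xs. set xs \<subseteq> {k. nat_of_num k \<le> n} \<and> length xs \<le> n}"
      using xs by (intro image_eqI[of _ _ xs]) auto
  qed
  ultimately show ?thesis using finite_surj by blast
qed

lemma finite_wt_eq: "finite {v. wt v = n}"
  by (rule finite_subset[OF _ finite_wt_le[of n]]) auto

text \<open>Indexes the coefficients of beta uniformly, with b_0 = 1 represented by the empty
  collection.\<close>

definition coll_of_wt :: "nat \<Rightarrow> collection" where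
  "coll_of_wt n = (if n = 0 then {#} else {#num_of_nat n#})"

lemma coll_of_wt_iff: "v = coll_of_wt n \<longleftrightarrow> size v \<le> 1 \<and> wt v = n"
proof (cases v)
  case empty
  then show ?thesis by (simp add: coll_of_wt_def)
next
  case (add k u)
  have "k = num_of_nat n \<longleftrightarrow> nat_of_num k = n" if "n > 0"
    using that by (auto simp: num_of_nat_inverse nat_of_num_inverse)
  then show ?thesis
    using add nat_of_num_pos[of k] by (auto simp: coll_of_wt_def)
qed

text \<open>In \<open>geom x\<close> the coefficient at \<open>w\<close> is an integer times x to
  the weight of \<open>w\<close> plus 1. Exponents and weights add under products, and the integer
  factor is read off at x = 1.\<close>

lemma geom_power_nth:
  fixes x :: "'a::comm_ring_1"
  shows "(geom x ^ n) $$ w = x ^ (wt w + n) * of_int ((geom 1 ^ n) $$ w)"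
proof (induction n arbitrary: w)
  case 0
  then show ?case by (simp add: mps_nth_one)
next
  case (Suc n)
  have "(geom x ^ Suc n) $$ w =
      (\<Sum>(a, b)\<in>splittings w. geom x $$ a * (x ^ (wt b + n) * of_int ((geom 1 ^ n) $$ b)))"
    by (simp add: mps_nth_mult Suc)
  also have "\<dots> = (\<Sum>(a, b)\<in>splittings w.
      x ^ (wt w + Suc n) * of_int (geom 1 $$ a * (geom 1 ^ n) $$ b))"
    by (intro sum.cong refl) (auto simp: geom_nth splittings_def power_add mult_ac)
  also have "\<dots> = x ^ (wt w + Suc n) * of_int ((geom 1 ^ Suc n) $$ w)"
    by (simp add: mps_nth_mult sum_distrib_left split_def)
  finally show ?case .
qed

text \<open>
  If the total operation on a geometric element is \<open>\<beta>(x) = x + \<Sum> b\<^sub>k x\<^sup>k\<^sup>+\<^sup>1\<close>, then performing \<open>b\<close> first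
  and \<open>b'\<close> next gives \<open>\<beta>(\<beta>'(x))\<close>. The coefficient of \<open>x\<^sup>n\<^sup>+\<^sup>1\<close> in this composition is \<open>comp_coeff n\<close>;
  the outer index refers to \<open>b\<close>, the inner one to \<open>b'\<close>.
\<close>

definition comp_coeff :: "nat \<Rightarrow> int mps mps" where
  "comp_coeff n = Abs_mps (\<lambda>w. Abs_mps (\<lambda>w'.
     if size w \<le> 1 \<and> wt w + wt w' = n then (geom 1 ^ (wt w + 1)) $$ w' else 0))"

definition comp_monom :: "collection \<Rightarrow> int mps mps" where
  "comp_monom v = (\<Prod>k\<in>#v. comp_coeff (nat_of_num k))"

lemma comp_monom_empty [simp]: "comp_monom {#} = 1"
  and comp_monom_add: "comp_monom (a + b) = comp_monom a * comp_monom b"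
  and comp_monom_add_mset: "comp_monom (add_mset k v) = comp_coeff (nat_of_num k) * comp_monom v"
  by (simp_all add: comp_monom_def)

lemma mps_nth_sum: "sum f A $$ w = (\<Sum>x\<in>A. f x $$ w)"
  by (induction A rule: infinite_finite_induct) auto

lemma mps_nth_nth_mult:
  "(f * g) $$ w $$ w' =
    (\<Sum>(p, q)\<in>splittings w. \<Sum>(p', q')\<in>splittings w'. f $$ p $$ p' * g $$ q $$ q')"
  by (simp add: mps_nth_mult mps_nth_sum split_def)

text \<open>\<open>comp_coeff n\<close> has total weight n in the two families of variables, and
  weights add. Hence only the finitely many \<open>v\<close> of one weight contribute to a given
  entry of \<open>comp_subst\<close>.\<close>

lemma comp_monom_wt_eq_0: "wt v \<noteq> wt w + wt w' \<Longrightarrow> comp_monom v $$ w $$ w' = 0"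
proof (induction v arbitrary: w w')
  case empty
  then show ?case by (auto simp: mps_nth_one)
next
  case (add k v)
  have "comp_coeff (nat_of_num k) $$ p $$ p' * comp_monom v $$ q $$ q' = 0"
    if "p + q = w" "p' + q' = w'" for p q p' q'
  proof (cases "wt p + wt p' = nat_of_num k")
    case True
    then have "comp_monom v $$ q $$ q' = 0" using add that by auto
    then show ?thesis by simp
  qed (simp add: comp_coeff_def)
  then show ?case
    unfolding comp_monom_add_mset mps_nth_nth_mult
    by (intro sum.neutral ballI) (auto simp: splittings_def intro!: sum.neutral)
qed

lemma comp_monom_size_le_1:
  assumes "size v \<le> 1"
  shows "comp_monom v $$ w $$ w' =
    (if size w \<le> 1 \<and> wt w + wt w' = wt v then (geom 1 ^ (wt w + 1)) $$ w' else 0)"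
proof (cases v)
  case empty
  then show ?thesis by (auto simp: mps_nth_one geom_nth)
next
  case (add k u)
  with assms have "v = {#k#}" by simp
  then show ?thesis by (simp add: comp_monom_def comp_coeff_def)
qed

text \<open>Dual to the product: substitutes \<open>comp_monom v\<close> for the monomial \<open>b\<^sup>v\<close>.\<close>

definition comp_subst :: "'a::comm_ring_1 mps \<Rightarrow> 'a mps mps" where
  "comp_subst f = Abs_mps (\<lambda>w. Abs_mps (\<lambda>w'.
     \<Sum>v | wt v = wt w + wt w'. of_int (comp_monom v $$ w $$ w') * f $$ v))"

text \<open>Gives the entries of both factors of a product one common range of summation.\<close>

lemma comp_subst_nth:
  assumes "wt w + wt w' \<le> n"
  shows "comp_subst f $$ w $$ w' = (\<Sum>v | wt v \<le> n. of_int (comp_monom v $$ w $$ w') * f $$ v)"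
  unfolding comp_subst_def mps_nth_Abs
  by (intro sum.mono_neutral_left finite_wt_le) (use assms in \<open>auto simp: comp_monom_wt_eq_0\<close>)

lemma ring_hom_comp_subst: "ring_hom (comp_subst :: 'a::comm_ring_1 mps \<Rightarrow> _)"
proof
  fix f g :: "'a mps"
  show "comp_subst (f + g) = comp_subst f + comp_subst g"
    by (intro mps_eqI) (simp add: comp_subst_def distrib_left sum.distrib)
  show "comp_subst (1 :: 'a mps) = 1"
  proof (intro mps_eqI)
    fix w w'
    have "comp_subst 1 $$ w $$ w' = (\<Sum>v | wt v \<le> wt w + wt w'.
        if v = {#} then of_int (1 $$ w $$ w') else (0::'a))"
      by (subst comp_subst_nth[OF order_refl]) (auto intro!: sum.cong simp: mps_nth_one)
    also have "\<dots> = 1 $$ w $$ w'"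
      by (simp add: finite_wt_le) (simp add: mps_nth_one)
    finally show "comp_subst (1 :: 'a mps) $$ w $$ w' = 1 $$ w $$ w'" .
  qed
  show "comp_subst (f * g) = comp_subst f * comp_subst g"
  proof (intro mps_eqI)
    fix w w'
    define n where "n = wt w + wt w'"
    define V where "V = {v. wt v \<le> n}"
    have V: "finite V" by (simp add: V_def finite_wt_le)
    define m where "m = (\<lambda>v. of_int (comp_monom v $$ w $$ w') :: 'a)"
    have "comp_subst (f * g) $$ w $$ w' = (\<Sum>v\<in>V. m v * (\<Sum>(a, b)\<in>splittings v. f $$ a * g $$ b))"
      by (simp add: comp_subst_nth[of w w' n] n_def V_def m_def mps_nth_mult)
    also have "\<dots> = (\<Sum>v\<in>V. \<Sum>(a, b)\<in>splittings v. m (a + b) * (f $$ a * g $$ b))"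
      by (auto intro!: sum.cong simp: sum_distrib_left splittings_def)
    also have "\<dots> = (\<Sum>(v, a, b)\<in>Sigma V splittings. m (a + b) * (f $$ a * g $$ b))"
      by (subst sum.Sigma) (auto simp: V finite_splittings split_def)
    also have "\<dots> = (\<Sum>(a, b)\<in>{(a, b). a + b \<in> V}. m (a + b) * (f $$ a * g $$ b))"
      by (rule sum.reindex_bij_witness[of _ "\<lambda>(a, b). (a + b, a, b)" snd])
         (auto simp: splittings_def)
    \<comment> \<open>The pairs added here have total weight above n, where \<open>m\<close>
      vanishes.\<close>
    also have "\<dots> = (\<Sum>(a, b)\<in>V \<times> V. m (a + b) * (f $$ a * g $$ b))"
    proof (rule sum.mono_neutral_left)
      show "\<forall>i\<in>V \<times> V - {(a, b). a + b \<in> V}. (case i of (a, b) \<Rightarrow> m (a + b) * (f $$ a * g $$ b)) = 0"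
      proof
        fix i assume "i \<in> V \<times> V - {(a, b). a + b \<in> V}"
        then have "fst i + snd i \<notin> V" by (cases i) auto
        then have "m (fst i + snd i) = 0"
          using comp_monom_wt_eq_0[of "fst i + snd i" w w'] by (auto simp: m_def V_def n_def)
        then show "(case i of (a, b) \<Rightarrow> m (a + b) * (f $$ a * g $$ b)) = 0"
          by (simp add: split_def)
      qed
    qed (use V in \<open>auto simp: V_def\<close>)
    also have "\<dots> = (\<Sum>(a, b)\<in>V \<times> V. \<Sum>(p, q)\<in>splittings w. \<Sum>(p', q')\<in>splittings w'.
        (of_int (comp_monom a $$ p $$ p') * f $$ a) * (of_int (comp_monom b $$ q $$ q') * g $$ b))"
      by (intro sum.cong refl)
         (simp add: m_def comp_monom_add mps_nth_nth_mult split_def sum_distrib_left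
           sum_distrib_right mult_ac)
    also have "\<dots> = (\<Sum>(p, q)\<in>splittings w. \<Sum>(p', q')\<in>splittings w'. \<Sum>(a, b)\<in>V \<times> V.
        (of_int (comp_monom a $$ p $$ p') * f $$ a) * (of_int (comp_monom b $$ q $$ q') * g $$ b))"
      unfolding split_def by (rule trans[OF sum.swap sum.cong[OF refl sum.swap]])
    also have "\<dots> = (\<Sum>(p, q)\<in>splittings w. \<Sum>(p', q')\<in>splittings w'.
        comp_subst f $$ p $$ p' * comp_subst g $$ q $$ q')"
    proof (intro sum.cong refl, clarify, intro sum.cong refl, clarify)
      fix p q p' q'
      assume "(p, q) \<in> splittings w" "(p', q') \<in> splittings w'"
      then have "wt p + wt p' \<le> n" "wt q + wt q' \<le> n"
        by (auto simp: splittings_def n_def)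
      then show "(\<Sum>(a, b)\<in>V \<times> V. (of_int (comp_monom a $$ p $$ p') * f $$ a) *
          (of_int (comp_monom b $$ q $$ q') * g $$ b)) = comp_subst f $$ p $$ p' * comp_subst g $$ q $$ q'"
        by (simp add: comp_subst_nth V_def sum_product sum.cartesian_product)
    qed
    also have "\<dots> = (comp_subst f * comp_subst g) $$ w $$ w'"
      by (simp add: mps_nth_nth_mult)
    finally show "comp_subst (f * g) $$ w $$ w' = (comp_subst f * comp_subst g) $$ w $$ w'" .
  qed
qed

text \<open>The right side is the coefficient of beta(beta'(x)). In \<open>geom x\<close> a single
  collection of each weight survives, so the defining sum has one term.\<close>

lemma comp_subst_geom:
  "comp_subst (geom x) $$ w $$ w' = (if size w \<le> 1 then (geom x ^ (wt w + 1)) $$ w' else 0)"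
proof -
  define n where "n = wt w + wt w'"
  have v0: "size (coll_of_wt n) \<le> 1" "wt (coll_of_wt n) = n"
    using coll_of_wt_iff[of "coll_of_wt n" n] by simp_all
  have "comp_subst (geom x) $$ w $$ w' = (\<Sum>v | wt v = n.
      if v = coll_of_wt n then of_int (comp_monom (coll_of_wt n) $$ w $$ w') * x ^ (n + 1) else 0)"
    unfolding comp_subst_def mps_nth_Abs n_def[symmetric]
  proof (intro sum.cong refl)
    fix v assume "v \<in> {v. wt v = n}"
    then show "of_int (comp_monom v $$ w $$ w') * geom x $$ v = (if v = coll_of_wt n
        then of_int (comp_monom (coll_of_wt n) $$ w $$ w') * x ^ (n + 1) else 0)"
      using coll_of_wt_iff[of v n] by (auto simp: geom_nth)
  qed
  also have "\<dots> = of_int (comp_monom (coll_of_wt n) $$ w $$ w') * x ^ (n + 1)"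
    using v0 by (simp add: finite_wt_eq)
  also have "\<dots> = (if size w \<le> 1 then (geom x ^ (wt w + 1)) $$ w' else 0)"
    using v0 geom_power_nth[of x "wt w + 1" w']
    by (simp add: comp_monom_size_le_1 n_def mult_ac add_ac)
  finally show ?thesis .
qed

section \<open>The product: structure constants and faithfulness\<close>

section \<open>The product of the Landweber--Novikov algebra\<close>

text \<open>Iterating the total operation and substituting \<open>comp_monom\<close> are both ring
  homomorphisms in \<open>p\<close>. On a variable both give beta(beta'(y)), by
  \<open>comp_subst_geom\<close>.\<close>

lemma poly_act_comp:
  "poly_act (s_op w') (poly_act (s_op w) p) =
   (\<Sum>v | wt v = wt w + wt w'. of_int (comp_monom v $$ w $$ w') * poly_act (s_op v) p)"
proof -
  define T where "T = total_op poly_act"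
  have hom: "ring_hom T" unfolding T_def by (rule ring_hom_total_op[OF cartan_action_poly_act])
  interpret T: ring_hom T by (rule hom)
  have "mps_map T (T p) = comp_subst (T p)"
  proof (rule ring_hom_eq_on_mpoly[where f = "\<lambda>p. mps_map T (T p)"])
    fix j
    have T_yvar: "T (yvar j) = geom (yvar j)"
      by (simp add: T_def total_op_poly_act_yvar)
    show "mps_map T (T (yvar j)) = comp_subst (T (yvar j))"
      unfolding T_yvar
      by (intro mps_eqI) (auto simp: comp_subst_geom geom_nth[of "yvar j"] T.mult T.power T.zero T_yvar)
  qed (simp_all add: ring_hom_comp hom ring_hom_mps_map ring_hom_comp_subst)
  then have "mps_map T (T p) $$ w $$ w' = comp_subst (T p) $$ w $$ w'" by simp
  then show ?thesis
    by (simp add: T_def comp_subst_def)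
qed

text \<open>The right factor acts first, so its collection \<open>w\<close> is the outer index of
  \<open>comp_monom v\<close>.\<close>

definition ln_prod :: "ln \<Rightarrow> ln \<Rightarrow> ln" where
  "ln_prod s t = lin (\<lambda>w'. lin (\<lambda>w. \<Sum>v | wt v = wt w + wt w'.
     Poly_Mapping.single v (comp_monom v $$ w $$ w')) t) s"

lemma poly_act_eq_lin: "poly_act s p = lin (\<lambda>w. poly_act (s_op w) p) s"
  using cartan_action_poly_act by (rule cartan_action_eq_lin)

lemma additive_poly_act: "additive (\<lambda>s. poly_act s p)" "additive (poly_act s)"
  using cartan_action_poly_act by (simp_all add: cartan_action_additive)

lemma additive_ln_prod: "additive (\<lambda>s. ln_prod s t)" "additive (ln_prod s)"
  by (auto intro!: additive.intro simp: ln_prod_def lin_add lin_def[of _ s] distrib_left sum.distrib)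

lemma additive_comp: "additive f \<Longrightarrow> additive g \<Longrightarrow> additive (\<lambda>x. f (g x))"
  by (simp add: additive_def)

lemma poly_act_ln_prod: "poly_act (ln_prod s t) p = poly_act s (poly_act t p)"
proof (rule additive_eq_on_frag[where f = "\<lambda>s. poly_act (ln_prod s t) p"])
  fix w'
  show "poly_act (ln_prod (Poly_Mapping.single w' 1) t) p =
      poly_act (Poly_Mapping.single w' 1) (poly_act t p)"
  proof (rule additive_eq_on_frag[where f = "\<lambda>t. poly_act (ln_prod (Poly_Mapping.single w' 1) t) p"])
    fix w
    have "poly_act (ln_prod (s_op w') (s_op w)) p = poly_act (s_op w') (poly_act (s_op w) p)"
      unfolding poly_act_comp poly_act_eq_lin[of "ln_prod (s_op w') (s_op w)"]
      by (simp add: ln_prod_def lin_sum)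
    then show "poly_act (ln_prod (Poly_Mapping.single w' 1) (Poly_Mapping.single w 1)) p =
        poly_act (Poly_Mapping.single w' 1) (poly_act (Poly_Mapping.single w 1) p)"
      by (simp add: s_op_def)
  qed (rule additive_comp[OF additive_poly_act(1) additive_ln_prod(2)],
      rule additive_comp[OF additive_poly_act(2) additive_poly_act(1)])
qed (rule additive_comp[OF additive_poly_act(1) additive_ln_prod(1)], rule additive_poly_act)

text \<open>
  The action is faithful: the coefficient of \<open>s_op w\<close> in \<open>s\<close> is read off \<open>s(y\<^sub>1 \<dots> y\<^sub>N)\<close> at the
  monomial \<open>y\<^sub>1\<^bsup>k\<^sub>1+1\<^esup> \<dots> y\<^sub>N\<^bsup>k\<^sub>N+1\<^esup>\<close>, where \<open>w = (k\<^sub>1, \<dots>, k\<^sub>N)\<close>.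
\<close>

fun yprod :: "nat \<Rightarrow> int_mpoly" where
  "yprod 0 = 1"
| "yprod (Suc n) = yprod n * yvar (Suc n)"

fun ymonom :: "num list \<Rightarrow> nat \<Rightarrow>\<^sub>0 nat" where
  "ymonom [] = 0"
| "ymonom (k # ks) = ymonom ks + Poly_Mapping.single (Suc (length ks)) (nat_of_num k + 1)"

lemma yprod_in_poly_ring: "yprod n \<in> poly_ring n"
proof (induction n)
  case (Suc n)
  show ?case
    unfolding poly_ring_def
  proof clarify
    fix m i assume m: "m \<in> Poly_Mapping.keys (yprod (Suc n))" and i: "i \<in> Poly_Mapping.keys m"
    from m obtain a where "a \<in> Poly_Mapping.keys (yprod n)" "m = a + Poly_Mapping.single (Suc n) 1"
      using keys_mult[of "yprod n" "yvar (Suc n)"] by (auto simp: yvar_def)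
    with i Suc keys_add[of a "Poly_Mapping.single (Suc n) 1"] show "i \<in> {1..Suc n}"
      by (fastforce simp: poly_ring_def)
  qed
qed (simp add: poly_ring_def)

lemma total_op_poly_act_mult:
  "total_op poly_act (p * q) = total_op poly_act p * total_op poly_act q"
  using ring_hom_total_op[OF cartan_action_poly_act] by (rule ring_hom.mult)

lemma total_op_poly_act_1: "total_op poly_act 1 = 1"
  using ring_hom_total_op[OF cartan_action_poly_act] by (rule ring_hom.one)

lemma poly_act_yprod_Suc:
  "poly_act (s_op v) (yprod (Suc n)) = (\<Sum>(a, b)\<in>splittings v.
     poly_act (s_op a) (yprod n) * (if size b \<le> 1 then yvar (Suc n) ^ (wt b + 1) else 0))"
proof -
  have "poly_act (s_op v) (yprod (Suc n)) = total_op poly_act (yprod (Suc n)) $$ v"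
    by simp
  also have "\<dots> = (total_op poly_act (yprod n) * geom (yvar (Suc n))) $$ v"
    by (simp only: yprod.simps total_op_poly_act_mult total_op_poly_act_yvar)
  finally show ?thesis
    by (simp add: mps_nth_mult geom_nth)
qed

text \<open>Each operation raises the given variables to powers and introduces no others. Hence the
  exponent of the last variable comes from the last factor alone.\<close>

lemma poly_act_yprod_keys:
  assumes "m \<in> Poly_Mapping.keys (poly_act (s_op v) (yprod n))" "i > n"
  shows "Poly_Mapping.lookup m i = 0"
  using assms
proof (induction n arbitrary: v m)
  case 0
  have "poly_act (s_op v) 1 = 1 $$ v"
    using arg_cong[OF total_op_poly_act_1, of "\<lambda>f. f $$ v"] by simp
  with 0 show ?case by (auto simp: mps_nth_one split: if_splits)
next
  case (Suc n)
  let ?g = "\<lambda>a b. poly_act (s_op a) (yprod n) *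
    (if size b \<le> 1 then yvar (Suc n) ^ (wt b + 1) else 0)"
  obtain a b where "m \<in> Poly_Mapping.keys (?g a b)"
    using Suc.prems(1) keys_sum[of "\<lambda>(a, b). ?g a b" "splittings v"]
    unfolding poly_act_yprod_Suc by (auto simp del: power_Suc)
  moreover from this have "size b \<le> 1" by (auto split: if_splits)
  ultimately have "m \<in> Poly_Mapping.keys (poly_act (s_op a) (yprod n) *
      Poly_Mapping.single (Poly_Mapping.single (Suc n) (wt b + 1)) 1)"
    by (simp add: yvar_power del: power_Suc)
  then obtain c where "c \<in> Poly_Mapping.keys (poly_act (s_op a) (yprod n))"
      "m = c + Poly_Mapping.single (Suc n) (wt b + 1)"
    using keys_mult[of "poly_act (s_op a) (yprod n)"
        "Poly_Mapping.single (Poly_Mapping.single (Suc n) (wt b + 1)) 1"] by auto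
  then show ?case
    using Suc.IH[of c a] Suc.prems(2) by (simp add: lookup_add lookup_single)
qed

lemma lookup_times_single:
  fixes p :: int_mpoly
  shows "Poly_Mapping.lookup (p * Poly_Mapping.single a 1) (m + a) = Poly_Mapping.lookup p m"
  by (rule additive_eq_on_frag[where f = "\<lambda>p. Poly_Mapping.lookup (p * Poly_Mapping.single a 1) (m + a)"])
     (auto intro!: additive.intro simp: lookup_add distrib_right mult_single lookup_single when_def)

lemma lookup_ymonom: "i > length ks \<Longrightarrow> Poly_Mapping.lookup (ymonom ks) i = 0"
  by (induction ks) (simp_all add: lookup_add lookup_single)

lemma lookup_poly_act_yprod:
  "Poly_Mapping.lookup (poly_act (s_op v) (yprod (length ks))) (ymonom ks) =
   (if v = mset ks then 1 else 0)"
proof (induction ks arbitrary: v)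
  case Nil
  have "poly_act (s_op v) 1 = 1 $$ v"
    using arg_cong[OF total_op_poly_act_1, of "\<lambda>f. f $$ v"] by simp
  then show ?case by (simp add: mps_nth_one)
next
  case (Cons k ks)
  define n where "n = length ks"
  define p where "p = (\<lambda>a. poly_act (s_op a) (yprod n))"
  have summand: "Poly_Mapping.lookup
      (p a * (if size b \<le> 1 then yvar (Suc n) ^ (wt b + 1) else 0)) (ymonom (k # ks)) =
      (if a = mset ks \<and> b = {#k#} then 1 else 0)" (is "?L = _") for a b
  proof (cases "b = {#k#}")
    case True
    then show ?thesis
      using Cons.IH[of a] lookup_times_single[of "p a" _ "ymonom ks"]
      by (simp add: yvar_power n_def p_def del: power_Suc)
  next
    case False
    have "?L = 0"
    proof (rule ccontr)
      assume L: "?L \<noteq> 0"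
      then have b: "size b \<le> 1" by (auto split: if_splits)
      with L have "ymonom (k # ks) \<in> Poly_Mapping.keys (p a *
          Poly_Mapping.single (Poly_Mapping.single (Suc n) (wt b + 1)) 1)"
        by (simp add: yvar_power in_keys_iff del: power_Suc)
      then obtain c where c: "c \<in> Poly_Mapping.keys (p a)"
          "ymonom (k # ks) = c + Poly_Mapping.single (Suc n) (wt b + 1)"
        using keys_mult[of "p a"
            "Poly_Mapping.single (Poly_Mapping.single (Suc n) (wt b + 1)) 1"] by auto
      \<comment> \<open>Comparing exponents of \<open>yvar (Suc n)\<close>: neither \<open>c\<close>
        nor \<open>ymonom ks\<close> involves it, and the two shifts by 1 cancel.\<close>
      have "nat_of_num k = wt b"
        using arg_cong[OF c(2), of "\<lambda>m. Poly_Mapping.lookup m (Suc n)"]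
          poly_act_yprod_keys[of c a n "Suc n"] c(1) lookup_ymonom[of ks "Suc n"]
        by (simp add: lookup_add n_def p_def)
      with b False show False
        using nat_of_num_pos[of k] by (cases b) (auto simp: num_eq_iff)
    qed
    with False show ?thesis by simp
  qed
  have "Poly_Mapping.lookup (poly_act (s_op v) (yprod (Suc n))) (ymonom (k # ks)) =
      (\<Sum>(a, b)\<in>splittings v. if a = mset ks \<and> b = {#k#} then 1 else 0)"
    unfolding poly_act_yprod_Suc lookup_sum
    by (intro sum.cong refl) (simp only: split_def summand[unfolded p_def])
  also have "\<dots> = (\<Sum>x\<in>splittings v. if x = (mset ks, {#k#}) then 1 else 0)"
    by (intro sum.cong refl) (simp add: split_def prod_eq_iff)
  also have "\<dots> = (if v = mset (k # ks) then 1 else 0)"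
    by (simp add: finite_splittings splittings_iff eq_commute)
  finally show ?case by (simp add: n_def)
qed

lemma poly_act_faithful:
  assumes "\<And>N p. p \<in> poly_ring N \<Longrightarrow> poly_act r p = poly_act r' p"
  shows "r = r'"
proof (rule poly_mapping_eqI)
  fix w :: collection
  obtain ks where ks: "mset ks = w" using ex_mset by blast
  have coeff: "Poly_Mapping.lookup (poly_act r (yprod (length ks))) (ymonom ks) =
      Poly_Mapping.lookup r w" for r
  proof (rule additive_eq_on_frag
      [where f = "\<lambda>r. Poly_Mapping.lookup (poly_act r (yprod (length ks))) (ymonom ks)"])
    fix v
    show "Poly_Mapping.lookup (poly_act (Poly_Mapping.single v 1) (yprod (length ks))) (ymonom ks) =
        Poly_Mapping.lookup (Poly_Mapping.single v 1) w"
      using lookup_poly_act_yprod[of v ks] by (simp add: s_op_def ks lookup_single when_def)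
  qed (auto intro!: additive.intro simp: lookup_add additive.add[OF additive_poly_act(1)])
  show "Poly_Mapping.lookup r w = Poly_Mapping.lookup r' w"
    using assms[OF yprod_in_poly_ring] by (simp flip: coeff)
qed

text \<open>\<open>poly_act_ln_prod\<close> shows that \<open>ln_prod\<close> fits the description,
  and faithfulness that nothing else does.\<close>

lemma ln_mult_eq: "ln_mult = ln_prod"
  unfolding ln_mult_def fun_eq_iff
  by (intro allI the_equality) (auto simp: poly_act_ln_prod intro!: poly_act_faithful)

lemma additive_ln_mult: "additive (\<lambda>s. ln_mult s t)" "additive (ln_mult s)"
  by (simp_all add: ln_mult_eq additive_ln_prod)

lemma ln_mult_assoc: "ln_mult (ln_mult r s) t = ln_mult r (ln_mult s t)"
  by (rule poly_act_faithful) (simp add: ln_mult_eq poly_act_ln_prod)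

lemma ln_mult_unit: "ln_mult (s_op {#}) s = s" "ln_mult s (s_op {#}) = s"
  using cartan_action_poly_act
  by (auto intro!: poly_act_faithful simp: ln_mult_eq poly_act_ln_prod cartan_action_def)

lemma lookup_ln_mult:
  "Poly_Mapping.lookup (ln_mult (s_op w') (s_op w)) v = comp_monom v $$ w $$ w'"
proof -
  have "Poly_Mapping.lookup (ln_mult (s_op w') (s_op w)) v =
      (\<Sum>u | wt u = wt w + wt w'. if u = v then comp_monom v $$ w $$ w' else 0)"
    unfolding ln_mult_eq ln_prod_def lin_s_op lookup_sum
    by (intro sum.cong) (auto simp: lookup_single when_def)
  then show ?thesis
    by (auto simp: finite_wt_eq comp_monom_wt_eq_0)
qed

section \<open>The dual, coefficientwise actions and the series alpha\<close>

section \<open>The dual as a Milnor module\<close>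

lemma pairing_eq_lin: "pairing l s = lin (Poly_Mapping.lookup l) s"
  by (simp add: pairing_def lin_def mult.commute)

lemma additive_pairing: "additive (pairing l)" "additive (\<lambda>l. pairing l s)"
proof -
  show "additive (pairing l)"
    using additive_lin[of "Poly_Mapping.lookup l"] by (simp add: additive_def pairing_eq_lin)
  show "additive (\<lambda>l. pairing l s)"
    by standard (simp add: pairing_def lookup_add distrib_right sum.distrib)
qed

lemma pairing_single: "pairing (Poly_Mapping.single v 1) s = Poly_Mapping.lookup s v"
  by (rule additive_eq_on_frag[where f = "pairing _"])
     (auto simp: additive_pairing pairing_def lookup_add lookup_single when_def intro: additive.intro)

lemma pairing_eqI:
  assumes "\<And>s. pairing l s = pairing m s"
  shows "l = m"
  using assms[of "s_op _"] by (intro poly_mapping_eqI) (simp add: pairing_s_op)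

text \<open>Weights add under the product, so nothing lighter than \<open>w'\<close> occurs in it.
  Therefore the functional that defines \<open>Rstar s l\<close> has finite support and lies in the
  graded dual.\<close>

lemma pairing_ln_mult_eq_0:
  assumes "\<And>v. v \<in> Poly_Mapping.keys l \<Longrightarrow> wt v < wt w'"
  shows "pairing l (ln_mult (s_op w') s) = 0"
proof (rule additive_eq_on_frag[where f = "\<lambda>s. pairing l (ln_mult (s_op w') s)"])
  fix w
  have "Poly_Mapping.lookup l v * comp_monom v $$ w $$ w' = 0" for v
    using assms[of v] comp_monom_wt_eq_0[of v w w'] by (cases "v \<in> Poly_Mapping.keys l") (auto simp: in_keys_iff)
  then show "pairing l (ln_mult (s_op w') (Poly_Mapping.single w 1)) = 0"
    by (auto intro!: sum.neutral simp: pairing_def lookup_ln_mult simp flip: s_op_def)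
qed (auto intro: additive_comp additive_pairing additive_ln_mult additive.intro)

lemma pairing_Rstar: "pairing (Rstar s l) s' = pairing l (ln_mult s' s)"
proof -
  let ?f = "\<lambda>w'. pairing l (ln_mult (s_op w') s)"
  have "{w'. ?f w' \<noteq> 0} \<subseteq> (\<Union>v\<in>Poly_Mapping.keys l. {w'. wt w' \<le> wt v})"
    using pairing_ln_mult_eq_0[of l _ s] by (force simp: not_le)
  then have "finite {w'. ?f w' \<noteq> 0}"
    by (rule finite_subset) (simp add: finite_wt_le)
  then obtain m :: ln_dual where m: "Poly_Mapping.lookup m w' = ?f w'" for w'
    using lookup_Abs_poly_mapping by metis
  have "pairing m s' = pairing l (ln_mult s' s)" for s'
    by (rule additive_eq_on_frag[where f = "pairing m"])
       (auto simp: additive_pairing additive_comp[OF additive_pairing(1) additive_ln_mult(1)]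
          pairing_s_op m simp flip: s_op_def)
  then have "\<exists>!m. \<forall>s'. pairing m s' = pairing l (ln_mult s' s)"
    by (metis pairing_eqI)
  then show ?thesis
    unfolding Rstar_def by (rule theI'[THEN spec])
qed

lemma lookup_Rstar: "Poly_Mapping.lookup (Rstar s l) w = pairing l (ln_mult (s_op w) s)"
  by (simp flip: pairing_s_op add: pairing_Rstar)

lemma lookup_Rstar_single:
  "Poly_Mapping.lookup (Rstar (s_op w) (Poly_Mapping.single v 1)) w' = comp_monom v $$ w $$ w'"
  by (simp add: lookup_Rstar pairing_single lookup_ln_mult)

definition dual_mps :: "ln_dual \<Rightarrow> int mps" where
  "dual_mps l = Abs_mps (Poly_Mapping.lookup l)"

lemma dual_mps_nth [simp]: "dual_mps l $$ w = Poly_Mapping.lookup l w"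
  by (simp add: dual_mps_def)

lemma lookup_dual_mult:
  fixes l m :: ln_dual
  shows "Poly_Mapping.lookup (l * m) w =
    (\<Sum>(a, b)\<in>splittings w. Poly_Mapping.lookup l a * Poly_Mapping.lookup m b)"
  using pairing_mult[of l m w] by (simp add: pairing_s_op)

lemma ring_hom_dual_mps: "ring_hom dual_mps"
  by standard (auto intro!: mps_eqI simp: lookup_add lookup_dual_mult mps_nth_mult mps_nth_one
      lookup_one when_def)

text \<open>Dually to the product, the operations on the dual substitute \<open>comp_coeff\<close>
  for the generators. Multiplicativity of \<open>comp_monom\<close> then gives the Cartan formula
  for \<open>Rstar\<close>, since \<open>dual_mps\<close> is injective.\<close>

lemma mps_map_dual_mps_Rstar: "mps_map dual_mps (total_op Rstar l) = lin comp_monom l"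
proof (intro mps_eqI)
  fix w w'
  show "mps_map dual_mps (total_op Rstar l) $$ w $$ w' = lin comp_monom l $$ w $$ w'"
    by (rule additive_eq_on_frag[where f = "\<lambda>l. mps_map dual_mps (total_op Rstar l) $$ w $$ w'"])
       (auto intro!: additive.intro simp: lookup_Rstar additive.add[OF additive_pairing(2)] lin_add
          pairing_single lookup_ln_mult)
qed

lemma cartan_action_Rstar: "cartan_action Rstar"
proof (rule cartan_actionI)
  let ?T = "total_op Rstar"
  interpret emb: ring_hom "mps_map dual_mps"
    by (intro ring_hom_mps_map ring_hom_dual_mps)
  interpret hom: ring_hom "\<lambda>l. mps_map dual_mps (?T l)"
    unfolding mps_map_dual_mps_Rstar
    by (rule ring_hom_lin) (simp_all add: comp_monom_add flip: empty_neutral(1))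
  have inj: "f = g" if "mps_map dual_mps f = mps_map dual_mps g" for f g
  proof (rule mps_eqI, rule poly_mapping_eqI)
    fix w w'
    show "Poly_Mapping.lookup (f $$ w) w' = Poly_Mapping.lookup (g $$ w) w'"
      using arg_cong[OF that, of "\<lambda>f. f $$ w $$ w'"] by simp
  qed
  show "ring_hom ?T"
    by standard (auto intro: inj simp: hom.add hom.one hom.mult emb.add emb.one emb.mult)
  show "Rstar (s_op {#}) l = l" for l
    by (rule pairing_eqI) (simp add: pairing_Rstar ln_mult_unit)
  show "Rstar (s + t) l = Rstar s l + Rstar t l" for s t l
    by (rule pairing_eqI) (simp add: pairing_Rstar additive.add[OF additive_ln_mult(2)]
        additive.add[OF additive_pairing(1)] additive.add[OF additive_pairing(2)])
qed

lemma milnor_module_Rstar: "milnor_module Rstar"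
  unfolding milnor_module_def
  by (auto intro!: pairing_eqI cartan_action_Rstar simp: pairing_Rstar ln_mult_assoc)

section \<open>Coefficientwise actions\<close>

definition fps_map :: "('a \<Rightarrow> 'b) \<Rightarrow> 'a fps \<Rightarrow> 'b fps" where
  "fps_map h f = Abs_fps (\<lambda>n. h (f $ n))"

lemma fps_nth_map [simp]: "fps_map h f $ n = h (f $ n)"
  by (simp add: fps_map_def)

lemma ring_hom_fps_map:
  assumes "ring_hom h" shows "ring_hom (fps_map h)"
proof -
  interpret ring_hom h by fact
  show ?thesis
    by standard (auto intro!: fps_ext sum.cong simp: add one zero fps_mult_nth sum mult)
qed

lemma fps_map_const: "h 0 = 0 \<Longrightarrow> fps_map h (fps_const c) = fps_const (h c)"
  by (auto intro!: fps_ext)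

lemma ring_hom_fps_const: "ring_hom fps_const"
  by standard simp_all

lemma sum_list_fps_nth: "(\<Sum>x\<leftarrow>xs. f x) $ n = (\<Sum>x\<leftarrow>xs. f x $ n)"
  by (induction xs) auto

lemma cartan_action_fps_map:
  fixes act :: "ln \<Rightarrow> 'a::comm_ring_1 \<Rightarrow> 'a"
  assumes "cartan_action act"
  shows "cartan_action (\<lambda>s. fps_map (act s))"
proof -
  have add: "act s (u + v) = act s u + act s v" "act (s + t) u = act s u + act t u"
    "act (s_op {#}) u = u" for s t u v
    using assms unfolding cartan_action_def by blast+
  have cartan: "act s (u * v) = (\<Sum>(s', s'')\<leftarrow>ps. act s' u * act s'' v)"
    if "coproduct s = (\<Sum>(s', s'')\<leftarrow>ps. tensor s' s'')" for s ps u v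
    using assms that unfolding cartan_action_def by blast
  have "fps_map (act s) (f * g) = (\<Sum>(s', s'')\<leftarrow>ps. fps_map (act s') f * fps_map (act s'') g)"
    if ps: "coproduct s = (\<Sum>(s', s'')\<leftarrow>ps. tensor s' s'')" for s ps f g
  proof (rule fps_ext)
    fix n
    have "fps_map (act s) (f * g) $ n = (\<Sum>i=0..n. act s (f $ i * g $ (n - i)))"
      by (simp add: fps_mult_nth additive.sum[OF cartan_action_additive(1)[OF assms]])
    also have "\<dots> = (\<Sum>i=0..n. \<Sum>(s', s'')\<leftarrow>ps. act s' (f $ i) * act s'' (g $ (n - i)))"
      by (simp add: cartan[OF ps])
    also have "\<dots> = (\<Sum>(s', s'')\<leftarrow>ps. \<Sum>i=0..n. act s' (f $ i) * act s'' (g $ (n - i)))"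
      by (induction ps) (auto simp: sum.distrib)
    also have "\<dots> = (\<Sum>(s', s'')\<leftarrow>ps. fps_map (act s') f * fps_map (act s'') g) $ n"
      by (simp add: sum_list_fps_nth split_def fps_mult_nth)
    finally show "fps_map (act s) (f * g) $ n =
      (\<Sum>(s', s'')\<leftarrow>ps. fps_map (act s') f * fps_map (act s'') g) $ n" .
  qed
  then show ?thesis
    unfolding cartan_action_def by (auto intro!: fps_ext simp: add)
qed

lemma milnor_module_fps_map:
  fixes act :: "ln \<Rightarrow> 'a::comm_ring_1 \<Rightarrow> 'a"
  assumes "milnor_module act"
  shows "milnor_module (\<lambda>s. fps_map (act s))"
  using assms unfolding milnor_module_def
  by (auto intro!: cartan_action_fps_map fps_ext)

lemma milnor_module_transport:
  fixes act :: "ln \<Rightarrow> 'b::comm_ring_1 \<Rightarrow> 'b" and \<phi> :: "'a::comm_ring_1 \<Rightarrow> 'b"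
  assumes "milnor_module act" "ring_hom \<phi>" "\<And>x. \<psi> (\<phi> x) = x" "\<And>y. \<phi> (\<psi> y) = y"
  shows "milnor_module (\<lambda>s u. \<psi> (act s (\<phi> u)))"
proof -
  interpret \<phi>: ring_hom \<phi> by fact
  interpret \<psi>: ring_hom \<psi> using assms(2-4) by (rule ring_hom_inverse)
  have act: "cartan_action act" "\<And>s t u. act (ln_mult s t) u = act s (act t u)"
    using assms(1) by (simp_all add: milnor_module_def)
  have \<psi>_sum_list: "\<psi> (sum_list xs) = (\<Sum>x\<leftarrow>xs. \<psi> x)" for xs
    by (induction xs) (simp_all add: \<psi>.zero \<psi>.add)
  have "\<psi> (act s (\<phi> (u * v))) = (\<Sum>(s', s'')\<leftarrow>ps. \<psi> (act s' (\<phi> u)) * \<psi> (act s'' (\<phi> v)))"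
    if "coproduct s = (\<Sum>(s', s'')\<leftarrow>ps. tensor s' s'')" for s ps u v
  proof -
    have "act s (\<phi> u * \<phi> v) = (\<Sum>(s', s'')\<leftarrow>ps. act s' (\<phi> u) * act s'' (\<phi> v))"
      using act(1) that unfolding cartan_action_def by blast
    then show ?thesis
      by (simp add: \<phi>.mult \<psi>_sum_list split_def comp_def \<psi>.mult)
  qed
  moreover have "act s (u + v) = act s u + act s v" "act (s + t) u = act s u + act t u"
    "act (s_op {#}) u = u" for s t u v
    using act(1) unfolding cartan_action_def by blast+
  ultimately show ?thesis
    by (auto simp: milnor_module_def cartan_action_def act(2) assms(3,4) \<phi>.add \<psi>.add)
qed

section \<open>The universal geometric element\<close>

definition alpha :: "ln_dual fps" where
  "alpha = Abs_fps (\<lambda>n. if n = 0 then 0 else Poly_Mapping.single (coll_of_wt (n - 1)) 1)"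

lemma alpha_nth_0 [simp]: "alpha $ 0 = 0"
  and alpha_nth_Suc: "alpha $ Suc n = Poly_Mapping.single (coll_of_wt n) 1"
  by (simp_all add: alpha_def)

lemma alpha_nth_1: "alpha $ Suc 0 = 1"
  by (simp add: alpha_nth_Suc coll_of_wt_def)

text \<open>\<open>alpha\<close> is \<open>geom 1\<close> with b^w read as a dual basis element and
  the power of y recording the weight. Each factor contributes an exponent one larger than its
  weight.\<close>

lemma lookup_alpha_power:
  "Poly_Mapping.lookup ((alpha ^ m) $ n) w = (if n = wt w + m then (geom 1 ^ m) $$ w else 0)"
proof (induction m arbitrary: n w)
  case 0
  then show ?case by (auto simp: mps_nth_one lookup_one when_def)
next
  case (Suc m)
  have alpha: "Poly_Mapping.lookup (alpha $ i) a = (if i = wt a + 1 then geom 1 $$ a else 0)" for i a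
    using coll_of_wt_iff[of a "i - 1"]
    by (cases i) (auto simp: alpha_nth_Suc lookup_single when_def geom_nth)
  have "Poly_Mapping.lookup ((alpha ^ Suc m) $ n) w = (\<Sum>i=0..n. \<Sum>(a, b)\<in>splittings w.
      Poly_Mapping.lookup (alpha $ i) a * Poly_Mapping.lookup ((alpha ^ m) $ (n - i)) b)"
    by (simp add: fps_mult_nth lookup_sum lookup_dual_mult)
  also have "\<dots> = (\<Sum>(a, b)\<in>splittings w. \<Sum>i=0..n.
      Poly_Mapping.lookup (alpha $ i) a * Poly_Mapping.lookup ((alpha ^ m) $ (n - i)) b)"
    unfolding split_def by (rule sum.swap)
  also have "\<dots> = (\<Sum>(a, b)\<in>splittings w. if n = wt w + Suc m then geom 1 $$ a * (geom 1 ^ m) $$ b else 0)"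
  proof (intro sum.cong refl, clarify)
    fix a b assume "(a, b) \<in> splittings w"
    then have w: "wt w = wt a + wt b" by (auto simp: splittings_def)
    have "(\<Sum>i=0..n. Poly_Mapping.lookup (alpha $ i) a * Poly_Mapping.lookup ((alpha ^ m) $ (n - i)) b) =
        (\<Sum>i=0..n. if i = wt a + 1 then
           (if n - i = wt b + m then geom 1 $$ a * (geom 1 ^ m) $$ b else 0) else 0)"
      by (intro sum.cong refl) (simp add: alpha Suc)
    also have "\<dots> = (if n = wt w + Suc m then geom 1 $$ a * (geom 1 ^ m) $$ b else 0)"
      by (auto simp: w)
    finally show "(\<Sum>i=0..n. Poly_Mapping.lookup (alpha $ i) a *
        Poly_Mapping.lookup ((alpha ^ m) $ (n - i)) b) =
        (if n = wt w + Suc m then geom 1 $$ a * (geom 1 ^ m) $$ b else 0)" .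
  qed
  also have "\<dots> = (if n = wt w + Suc m then (geom 1 ^ Suc m) $$ w else 0)"
    by (simp add: mps_nth_mult)
  finally show ?case .
qed

text \<open>An operation on a coefficient of \<open>alpha\<close> reads off an entry of
  \<open>comp_coeff\<close>, and these entries are those of the powers of \<open>geom 1\<close>,
  hence of the powers of \<open>alpha\<close>.\<close>

lemma total_op_alpha: "total_op (\<lambda>s. fps_map (Rstar s)) alpha = geom alpha"
proof (intro mps_eqI fps_ext poly_mapping_eqI)
  fix w n w'
  show "Poly_Mapping.lookup (total_op (\<lambda>s. fps_map (Rstar s)) alpha $$ w $ n) w' =
      Poly_Mapping.lookup (geom alpha $$ w $ n) w'"
  proof (cases n)
    case 0
    then show ?thesis
      by (simp add: geom_nth additive.zero[OF cartan_action_additive(1)[OF cartan_action_Rstar]])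
  next
    case (Suc i)
    have "size (coll_of_wt i) \<le> 1" "wt (coll_of_wt i) = i"
      using coll_of_wt_iff[of "coll_of_wt i" i] by simp_all
    then show ?thesis
      using lookup_alpha_power[of "wt w + 1" n w']
      by (auto simp: Suc alpha_nth_Suc lookup_Rstar_single comp_monom_size_le_1 geom_nth)
  qed
qed

section \<open>Substitution and homogeneity in power series rings\<close>

section \<open>Substitution into power series over commutative rings\<close>

text \<open>The difference collects the products whose exponents add up to more than n. It serves
  for z = c in \<open>fps_compose_mult\<close> and for z = x1 + x2 in
  \<open>ring_hom_subst_sum\<close>.\<close>

lemma truncated_product:
  fixes z :: "'a::comm_ring_1"
  shows "z ^ Suc n dvd (\<Sum>i\<le>n. a i * z ^ i) * (\<Sum>j\<le>n. b j * z ^ j) -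
    (\<Sum>k\<le>n. (\<Sum>i\<le>k. a i * b (k - i)) * z ^ k)"
proof -
  let ?g = "\<lambda>(i, j). a i * b j * z ^ (i + j)"
  have low: "{(i, j). i + j \<le> n} \<subseteq> {..n} \<times> {..n}" by auto
  have "(\<Sum>i\<le>n. a i * z ^ i) * (\<Sum>j\<le>n. b j * z ^ j) = sum ?g ({..n} \<times> {..n})"
    by (simp add: sum_product sum.cartesian_product power_add mult_ac)
  also have "\<dots> = sum ?g ({..n} \<times> {..n} - {(i, j). i + j \<le> n}) + sum ?g {(i, j). i + j \<le> n}"
    by (rule sum.subset_diff[OF low]) simp
  also have "sum ?g {(i, j). i + j \<le> n} = (\<Sum>k\<le>n. (\<Sum>i\<le>k. a i * b (k - i)) * z ^ k)"
    by (subst sum.triangle_reindex_eq) (simp add: sum_distrib_right)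
  finally have "(\<Sum>i\<le>n. a i * z ^ i) * (\<Sum>j\<le>n. b j * z ^ j) -
      (\<Sum>k\<le>n. (\<Sum>i\<le>k. a i * b (k - i)) * z ^ k) =
      sum ?g ({..n} \<times> {..n} - {(i, j). i + j \<le> n})"
    by simp
  also have "z ^ Suc n dvd \<dots>"
    by (intro dvd_sum) (auto intro!: dvd_mult le_imp_power_dvd simp del: power_Suc)
  finally show ?thesis .
qed

lemma fps_nth_dvd_power:
  fixes c :: "'a::comm_ring_1 fps"
  assumes "c $ 0 = 0" "c ^ n dvd f" "k < n"
  shows "f $ k = 0"
proof -
  obtain g where "f = c ^ n * g" using assms(2) by blast
  moreover have "c ^ n $ i = 0" if "i \<le> k" for i
    using startsby_zero_power_prefix[OF assms(1), of n] that assms(3) by simp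
  ultimately show ?thesis by (simp add: fps_mult_nth)
qed

lemma fps_compose_nth_truncated:
  fixes c :: "'a::comm_ring_1 fps"
  assumes "c $ 0 = 0" "k \<le> n"
  shows "(a oo c) $ k = (\<Sum>i\<le>n. fps_const (a $ i) * c ^ i) $ k"
proof -
  have "(a oo c) $ k = (\<Sum>i\<le>k. a $ i * c ^ i $ k)"
    by (simp add: fps_compose_nth atLeast0AtMost)
  also have "\<dots> = (\<Sum>i\<le>n. a $ i * c ^ i $ k)"
    using assms startsby_zero_power_prefix[OF assms(1)] by (intro sum.mono_neutral_left) auto
  finally show ?thesis by (simp add: fps_sum_nth)
qed

text \<open>The library has this for integral domains only.\<close>

lemma fps_compose_mult:
  fixes c :: "'a::comm_ring_1 fps"
  assumes c: "c $ 0 = 0"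
  shows "(a * b) oo c = (a oo c) * (b oo c)"
proof (rule fps_ext)
  fix n
  let ?P = "\<lambda>a. \<Sum>i\<le>n. fps_const (a $ i) * c ^ i"
  have "((a oo c) * (b oo c)) $ n = (?P a * ?P b) $ n"
    by (simp only: fps_mult_nth) (intro sum.cong refl, simp add: fps_compose_nth_truncated[OF c, of _ n])
  moreover have "(?P a * ?P b) $ n = ?P (a * b) $ n"
  proof -
    interpret c: ring_hom "fps_const :: 'a \<Rightarrow> 'a fps" by (rule ring_hom_fps_const)
    have "?P (a * b) = (\<Sum>k\<le>n. (\<Sum>i\<le>k. fps_const (a $ i) * fps_const (b $ (k - i))) * c ^ k)"
      by (intro sum.cong refl) (simp add: fps_mult_nth atLeast0AtMost c.sum)
    then have "c ^ Suc n dvd ?P a * ?P b - ?P (a * b)"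
      using truncated_product[of c n "\<lambda>i. fps_const (a $ i)" "\<lambda>i. fps_const (b $ i)"] by simp
    then have "(?P a * ?P b - ?P (a * b)) $ n = 0"
      by (rule fps_nth_dvd_power[OF c]) simp
    then show ?thesis by simp
  qed
  ultimately show "((a * b) oo c) $ n = ((a oo c) * (b oo c)) $ n"
    by (simp only: fps_compose_nth_truncated[OF c order_refl])
qed

lemma ring_hom_fps_compose:
  fixes c :: "'a::comm_ring_1 fps"
  assumes "c $ 0 = 0"
  shows "ring_hom (\<lambda>a. a oo c)"
  by standard (simp_all add: fps_compose_add_distrib fps_compose_mult[OF assms])

lemma fps_compose_nth_split:
  fixes c :: "'a::comm_ring_1 fps"
  assumes "c $ 0 = 0" "c $ 1 = 1"
  shows "(a oo c) $ n = (\<Sum>i<n. a $ i * c ^ i $ n) + a $ n"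
proof -
  have "(a oo c) $ n = (\<Sum>i<Suc n. a $ i * c ^ i $ n)"
    by (simp only: fps_compose_nth lessThan_Suc_atMost atLeast0AtMost)
  then show ?thesis
    using startsby_zero_power_nth_same[OF assms(1), of n] assms(2) by simp
qed

text \<open>Forward substitution in the triangular system \<open>fps_compose_nth_split\<close>,
  whose diagonal entries are 1.\<close>

fun fps_uncompose_nth :: "'a::comm_ring_1 fps \<Rightarrow> 'a fps \<Rightarrow> nat \<Rightarrow> 'a" where
  "fps_uncompose_nth c f n = f $ n - (\<Sum>i<n. fps_uncompose_nth c f i * c ^ i $ n)"

lemma bij_fps_compose:
  fixes c :: "'a::comm_ring_1 fps"
  assumes c: "c $ 0 = 0" "c $ 1 = 1"
  shows "bij (\<lambda>a. a oo c)"
proof (rule bijI)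
  show "inj (\<lambda>a. a oo c)"
  proof (rule injI, rule fps_ext)
    fix a b :: "'a fps" and n assume eq: "a oo c = b oo c"
    show "a $ n = b $ n"
    proof (induction n rule: less_induct)
      case (less n)
      then show ?case
        using arg_cong[OF eq, of "\<lambda>f. f $ n"] by (simp add: fps_compose_nth_split[OF c])
    qed
  qed
  show "surj (\<lambda>a. a oo c)"
  proof (rule surjI)
    show "Abs_fps (fps_uncompose_nth c f) oo c = f" for f
    proof (rule fps_ext)
      show "(Abs_fps (fps_uncompose_nth c f) oo c) $ n = f $ n" for n
        using fps_uncompose_nth.simps[of c f n]
        by (simp add: fps_compose_nth_split[OF c] del: fps_uncompose_nth.simps)
    qed
  qed
qed

lemma fps_map_compose:
  assumes "ring_hom h"
  shows "fps_map h (a oo c) = fps_map h a oo fps_map h c"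
proof (rule fps_ext)
  fix n
  interpret ring_hom h by fact
  interpret map: ring_hom "fps_map h" using assms by (rule ring_hom_fps_map)
  have "h (c ^ i $ n) = fps_map h c ^ i $ n" for i
    using arg_cong[OF map.power[of c i], of "\<lambda>f. f $ n"] by simp
  then show "fps_map h (a oo c) $ n = (fps_map h a oo fps_map h c) $ n"
    by (simp add: fps_compose_nth sum mult)
qed

lemma bij_fps_map:
  assumes "bij h" shows "bij (fps_map h)"
proof (rule bijI)
  show "inj (fps_map h)"
    using bij_is_inj[OF assms] by (auto intro!: injI simp: fps_eq_iff inj_eq)
  show "surj (fps_map h)"
    using bij_is_surj[OF assms] by (auto intro!: surjI[of _ "fps_map (inv h)"] fps_ext simp: surj_f_inv_f)
qed

section \<open>Graded rings\<close>

locale graded =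
  fixes H :: "int \<Rightarrow> 'a::comm_ring_1 \<Rightarrow> bool"
  assumes zero [simp]: "H d 0" and one: "H 0 1"
    and diff: "H d a \<Longrightarrow> H d b \<Longrightarrow> H d (a - b)"
    and mult: "H d a \<Longrightarrow> H e b \<Longrightarrow> H (d + e) (a * b)"
begin

lemma add: "H d a \<Longrightarrow> H d b \<Longrightarrow> H d (a + b)"
  using diff[of d a "0 - b"] diff[of d 0 b] by simp

lemma sum: "(\<And>i. i \<in> I \<Longrightarrow> H d (f i)) \<Longrightarrow> H d (sum f I)"
  by (induction I rule: infinite_finite_induct) (simp_all add: add)

lemma power: "H d a \<Longrightarrow> H (int n * d) (a ^ n)"
proof (induction n)
  case (Suc n)
  then show ?case using mult[of d a "int n * d" "a ^ n"] by (simp add: algebra_simps)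
qed (simp add: one)

end

definition fps_homogeneous :: "(int \<Rightarrow> 'a \<Rightarrow> bool) \<Rightarrow> int \<Rightarrow> 'a fps \<Rightarrow> bool" where
  "fps_homogeneous H d f \<longleftrightarrow> (\<forall>n. H (d - 2 * int n) (f $ n))"

lemma graded_fps_homogeneous:
  assumes "graded H" shows "graded (fps_homogeneous H)"
proof -
  interpret graded H by fact
  show ?thesis
  proof
    fix d e :: int and f g :: "'a fps"
    assume f: "fps_homogeneous H d f" and g: "fps_homogeneous H e g"
    show "fps_homogeneous H (d + e) (f * g)"
      unfolding fps_homogeneous_def fps_mult_nth
    proof (intro allI sum)
      fix n i :: nat assume "i \<in> {0..n}"
      then have "d - 2 * int i + (e - 2 * int (n - i)) = d + e - 2 * int n"
        by (simp add: of_nat_diff)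
      moreover have "H (d - 2 * int i) (f $ i)" "H (e - 2 * int (n - i)) (g $ (n - i))"
        using f g unfolding fps_homogeneous_def by blast+
      ultimately show "H (d + e - 2 * int n) (f $ i * g $ (n - i))"
        using mult by metis
    qed
  next
    show "fps_homogeneous H 0 1"
      by (auto simp: fps_homogeneous_def one)
  qed (auto simp: fps_homogeneous_def diff)
qed

text \<open>By the triangular form, \<open>a $ n\<close> is a coefficient of the composite minus
  terms in earlier coefficients of \<open>a\<close>, all of the same degree by induction.\<close>

lemma homogeneous_of_compose:
  fixes c :: "'a::comm_ring_1 fps"
  assumes "graded H" "fps_homogeneous H 2 c" "c $ 0 = 0" "c $ 1 = 1" "fps_homogeneous H d (a oo c)"
  shows "fps_homogeneous H d a"
proof -
  interpret graded H by fact
  interpret fps: graded "fps_homogeneous H" using assms(1) by (rule graded_fps_homogeneous)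
  have "H (d - 2 * int n) (a $ n)" for n
  proof (induction n rule: less_induct)
    case (less n)
    have "H (d - 2 * int n) (a $ i * c ^ i $ n)" if "i < n" for i
    proof -
      have "H (int i * 2 - 2 * int n) (c ^ i $ n)"
        using fps.power[OF assms(2), of i] by (simp add: fps_homogeneous_def)
      from mult[OF less[OF that] this] show ?thesis by (simp add: algebra_simps)
    qed
    then have "H (d - 2 * int n) ((a oo c) $ n - (\<Sum>i<n. a $ i * c ^ i $ n))"
      using assms(5) by (intro diff sum) (auto simp: fps_homogeneous_def)
    then show ?case by (simp add: fps_compose_nth_split[OF assms(3,4)])
  qed
  then show ?thesis by (simp add: fps_homogeneous_def)
qed

lemma deg_add: "deg (a + b) = deg a + deg b"
  by (simp add: deg_def)

lemma deg_eq_wt: "deg w = 2 * wt w"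
  by (simp add: deg_def wt_def)

lemma graded_dual_homogeneous: "graded dual_homogeneous"
proof
  fix d e and l m :: ln_dual
  assume "dual_homogeneous d l" "dual_homogeneous e m"
  then show "dual_homogeneous (d + e) (l * m)"
    using keys_mult[of l m] by (fastforce simp: dual_homogeneous_def deg_add)
next
  fix d and l m :: ln_dual
  assume "dual_homogeneous d l" "dual_homogeneous d m"
  then show "dual_homogeneous d (l - m)"
    using keys_diff[of l m] by (auto simp: dual_homogeneous_def)
qed (simp_all add: dual_homogeneous_def deg_def)

lemma series_homogeneous_eq:
  "series_homogeneous = fps_homogeneous (fps_homogeneous dual_homogeneous)"
proof (intro ext)
  fix d f
  have "d - 2 * int j - 2 * int i = d - 2 * int i - 2 * int j" for i j
    by simp
  then show "series_homogeneous d f = fps_homogeneous (fps_homogeneous dual_homogeneous) d f"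
    unfolding series_homogeneous_def fps_homogeneous_def by metis
qed

section \<open>The change of coordinates x_i = alpha(y_i)\<close>

section \<open>Coordinates on which the operations act trivially\<close>

definition coeff_act :: "ln \<Rightarrow> dual_series \<Rightarrow> dual_series" where
  "coeff_act s = fps_map (fps_map (Rstar s))"

text \<open>The inner composition replaces x_1 by alpha(y_1), the outer one x_2 by alpha(y_2).
  \<open>fps_const\<close> makes the coefficients of the second \<open>alpha\<close> constant in
  y_1.\<close>

definition recoord :: "dual_series \<Rightarrow> dual_series" where
  "recoord f = fps_map (\<lambda>g. g oo alpha) f oo fps_map fps_const alpha"

lemma ring_hom_recoord: "ring_hom recoord"
  unfolding recoord_def
  by (intro ring_hom_comp[OF ring_hom_fps_compose] ring_hom_fps_map ring_hom_fps_compose) simp_all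

lemma bij_recoord: "bij recoord"
proof -
  have "bij (fps_map (\<lambda>g. g oo alpha))"
    by (intro bij_fps_map bij_fps_compose) (simp_all add: alpha_nth_1)
  moreover have "bij (\<lambda>f. f oo fps_map fps_const alpha)"
    by (intro bij_fps_compose) (simp_all add: alpha_nth_1)
  ultimately have "bij ((\<lambda>f. f oo fps_map fps_const alpha) \<circ> fps_map (\<lambda>g. g oo alpha))"
    by (rule bij_comp)
  then show ?thesis by (simp add: recoord_def[abs_def] comp_def)
qed

lemma recoord_inv [simp]: "recoord (inv recoord f) = f" "inv recoord (recoord f) = f"
  using bij_recoord by (simp_all add: bij_is_surj surj_f_inv_f bij_is_inj)

lemma recoord_const: "recoord (const_series l) = const_series l"
  by (simp add: recoord_def const_series_def fps_map_const)

lemma recoord_x1: "recoord x1 = fps_const alpha"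
  by (simp add: recoord_def x1_def fps_map_const)

lemma recoord_x2: "recoord x2 = fps_map fps_const alpha"
proof -
  have "fps_map (\<lambda>g. g oo alpha) fps_X = fps_X"
    by (rule fps_ext) (simp add: fps_X_def)
  then show ?thesis by (simp add: recoord_def x2_def)
qed

text \<open>Ring homomorphisms preserve powers, so equivariance suffices. All geometric elements
  below arise from \<open>alpha\<close> in this way.\<close>

lemma total_op_transfer:
  fixes act :: "ln \<Rightarrow> 'a::comm_ring_1 \<Rightarrow> 'a" and act' :: "ln \<Rightarrow> 'b::comm_ring_1 \<Rightarrow> 'b"
  assumes "ring_hom h" "\<And>s. act' s (h u) = h (act s u)" "total_op act u = geom u"
  shows "total_op act' (h u) = geom (h u)"
proof -
  interpret ring_hom h by fact
  have "act (s_op w) u = geom u $$ w" for w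
    using arg_cong[OF assms(3), of "\<lambda>f. f $$ w"] by simp
  then show ?thesis
    by (intro mps_eqI) (auto simp: assms(2) geom_nth power mult zero)
qed

lemma Rstar_zero [simp]: "Rstar s 0 = 0"
  by (rule additive.zero[OF cartan_action_additive(1)[OF cartan_action_Rstar]])

lemma fps_map_Rstar_zero [simp]: "fps_map (Rstar s) 0 = 0"
  by (rule fps_ext) simp

lemma coeff_act_const: "coeff_act s (const_series l) = const_series (Rstar s l)"
  by (simp add: coeff_act_def const_series_def fps_map_const)

lemma total_op_coeff_act_recoord:
  "total_op coeff_act (recoord x1) = geom (recoord x1)"
  "total_op coeff_act (recoord x2) = geom (recoord x2)"
proof -
  show "total_op coeff_act (recoord x1) = geom (recoord x1)"
    unfolding recoord_x1
    by (intro total_op_transfer[OF ring_hom_fps_const _ total_op_alpha])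
       (simp add: coeff_act_def fps_map_const)
  show "total_op coeff_act (recoord x2) = geom (recoord x2)"
    unfolding recoord_x2
    by (intro total_op_transfer[OF ring_hom_fps_map[OF ring_hom_fps_const] _ total_op_alpha])
       (auto intro!: fps_ext simp: coeff_act_def)
qed

lemma milnor_module_coeff_act: "milnor_module coeff_act"
  unfolding coeff_act_def by (intro milnor_module_fps_map milnor_module_Rstar)

text \<open>
  Both operations map \<open>x\<^sup>n h\<close> into the ideal of \<open>x\<^sup>n\<close>, so agreement modulo all powers of \<open>x\<close> suffices.
\<close>

lemma total_op_eq_by_approx:
  fixes T T' :: "'a::comm_ring_1 \<Rightarrow> 'a mps"
  assumes "ring_hom T" "ring_hom T'" "T x = geom x" "T' x = geom x"
    and approx: "\<And>n. \<exists>p h. u = p + x ^ n * h \<and> T p = T' p"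
    and sep: "\<And>f. (\<And>n. x ^ n dvd f) \<Longrightarrow> f = 0"
  shows "T u = T' u"
proof (rule mps_eqI)
  fix w
  interpret T: ring_hom T by fact
  interpret T': ring_hom T' by fact
  have "x ^ n dvd (T u - T' u) $$ w" for n
  proof -
    obtain p h where "u = p + x ^ n * h" "T p = T' p" using approx by blast
    then have "T u - T' u = geom x ^ n * (T h - T' h)"
      by (simp add: T.add T'.add T.mult T'.mult T.power T'.power assms(3,4) algebra_simps)
    then show ?thesis
      by (auto simp: mps_nth_mult geom_power_nth[of x n] power_add intro!: dvd_sum)
  qed
  then have "(T u - T' u) $$ w = 0" by (rule sep)
  then show "T u $$ w = T' u $$ w" by simp
qed

lemma fps_expand_upto:
  fixes f :: "'a::comm_ring_1 fps"
  shows "f = (\<Sum>i<n. fps_const (f $ i) * fps_X ^ i) + fps_X ^ n * fps_shift n f"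
proof (rule fps_ext)
  fix k
  have "(\<Sum>i<n. fps_const (f $ i) * fps_X ^ i) $ k = (\<Sum>i<n. if i = k then f $ k else 0)"
    unfolding fps_sum_nth by (intro sum.cong refl) (simp add: fps_X_power_nth)
  then show "f $ k = ((\<Sum>i<n. fps_const (f $ i) * fps_X ^ i) + fps_X ^ n * fps_shift n f) $ k"
    by (simp add: fps_X_power_mult_nth)
qed

text \<open>Agreement spreads in two stages: from constants to series in x1 alone, by truncation in
  x1, and then to all series, by truncation in x2 with coefficients covered by the first
  stage.\<close>

lemma total_op_series_unique:
  fixes T T' :: "dual_series \<Rightarrow> dual_series mps"
  assumes "ring_hom T" "ring_hom T'" "T x1 = geom x1" "T' x1 = geom x1"
    and "T x2 = geom x2" "T' x2 = geom x2" "\<And>l. T (const_series l) = T' (const_series l)"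
  shows "T u = T' u"
proof -
  interpret T: ring_hom T by fact
  interpret T': ring_hom T' by fact
  have sum_eq: "T (\<Sum>i<n. f i * x ^ i) = T' (\<Sum>i<n. f i * x ^ i)"
    if "\<And>i. T (f i) = T' (f i)" "T x = T' x" for f x and n :: nat
    using that by (simp add: T.sum T'.sum T.mult T'.mult T.power T'.power)
  have inner: "T (fps_const g) = T' (fps_const g)" for g
  proof (rule total_op_eq_by_approx[OF assms(1-4)])
    fix n
    interpret c: ring_hom "fps_const :: ln_dual fps \<Rightarrow> dual_series" by (rule ring_hom_fps_const)
    have "fps_const g = (\<Sum>i<n. const_series (g $ i) * x1 ^ i) + x1 ^ n * fps_const (fps_shift n g)"
      by (subst fps_expand_upto[of g n])
         (simp only: c.add c.sum c.mult c.power const_series_def x1_def)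
    then show "\<exists>p h. fps_const g = p + x1 ^ n * h \<and> T p = T' p"
      using sum_eq[of "\<lambda>i. const_series (g $ i)" x1 n] assms(3,4,7) by auto
  next
    fix f assume dvd: "\<And>n. x1 ^ n dvd f"
    have "f $ j $ i = 0" for i j
    proof -
      obtain g where "f = x1 ^ Suc i * g" using dvd by blast
      then show ?thesis
        by (simp add: x1_def fps_const_power fps_X_power_mult_nth del: power_Suc)
    qed
    then show "f = 0" by (auto intro!: fps_ext)
  qed
  show ?thesis
  proof (rule total_op_eq_by_approx[OF assms(1,2,5,6)])
    fix n
    show "\<exists>p h. u = p + x2 ^ n * h \<and> T p = T' p"
    proof (intro exI conjI)
      show "u = (\<Sum>i<n. fps_const (u $ i) * x2 ^ i) + x2 ^ n * fps_shift n u"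
        unfolding x2_def by (rule fps_expand_upto)
      show "T (\<Sum>i<n. fps_const (u $ i) * x2 ^ i) = T' (\<Sum>i<n. fps_const (u $ i) * x2 ^ i)"
        by (rule sum_eq) (simp_all add: inner assms(5,6))
    qed
  next
    fix f assume dvd: "\<And>n. x2 ^ n dvd f"
    have "f $ j = 0" for j
    proof -
      obtain g where "f = x2 ^ Suc j * g" using dvd by blast
      then show ?thesis by (simp add: x2_def fps_X_power_mult_nth del: power_Suc)
    qed
    then show "f = 0" by (auto intro!: fps_ext)
  qed
qed

text \<open>The transported coefficientwise action satisfies every clause defining
  \<open>series_act\<close>, and \<open>total_op_series_unique\<close> excludes any other.\<close>

lemma series_act_eq: "series_act = (\<lambda>s f. inv recoord (coeff_act s (recoord f)))" (is "_ = ?act")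
proof -
  have unit: "geometric_values act x \<longleftrightarrow> total_op act x = geom x"
    if "milnor_module act" for act and x :: dual_series
    using that by (intro geometric_values_iff) (simp add: milnor_module_def cartan_action_def)
  have milnor: "milnor_module ?act"
    by (rule milnor_module_transport[OF milnor_module_coeff_act ring_hom_recoord]) simp_all
  interpret recoord: ring_hom recoord by (rule ring_hom_recoord)
  have inv_hom: "ring_hom (inv recoord)"
    by (rule ring_hom_inverse[OF ring_hom_recoord]) simp_all
  have "total_op ?act (inv recoord (recoord x)) = geom (inv recoord (recoord x))"
    if "total_op coeff_act (recoord x) = geom (recoord x)" for x
    using inv_hom _ that by (rule total_op_transfer) simp
  then have geom: "total_op ?act x1 = geom x1" "total_op ?act x2 = geom x2"
    using total_op_coeff_act_recoord by simp_all
  have const: "?act s (const_series l) = const_series (Rstar s l)" for s l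
    using recoord_inv(2)[of "const_series (Rstar s l)"] by (simp add: recoord_const coeff_act_const)
  show ?thesis
    unfolding series_act_def
  proof (rule the_equality)
    fix act :: "ln \<Rightarrow> dual_series \<Rightarrow> dual_series"
    assume act: "milnor_module act \<and> (\<forall>s l. act s (const_series l) = const_series (Rstar s l)) \<and>
      geometric_values act x1 \<and> geometric_values act x2"
    then have cartan: "cartan_action act" "cartan_action ?act"
      using milnor by (simp_all add: milnor_module_def)
    show "act = ?act"
    proof (rule cartan_action_eqI[OF cartan])
      have "total_op act (const_series l) = total_op ?act (const_series l)" for l
        using act const by (simp add: total_op_def)
      moreover have "total_op act x1 = geom x1" "total_op act x2 = geom x2"
        using act unit by blast+
      ultimately show "total_op act u = total_op ?act u" for u
        using total_op_series_unique[OF ring_hom_total_op[OF cartan(1)] ring_hom_total_op[OF cartan(2)]]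
          geom by blast
    qed
  qed (use milnor const geom unit in auto)
qed

lemma geometric_values_series_act:
  "geometric_values series_act f \<longleftrightarrow> total_op coeff_act (recoord f) = geom (recoord f)"
proof -
  interpret recoord: ring_hom recoord by (rule ring_hom_recoord)
  have "series_act (s_op {#}) u = u" for u
    using milnor_module_coeff_act by (simp add: series_act_eq milnor_module_def cartan_action_def)
  then have "geometric_values series_act f \<longleftrightarrow> total_op series_act f = geom f"
    by (rule geometric_values_iff)
  also have "\<dots> \<longleftrightarrow> (\<forall>w. recoord (series_act (s_op w) f) = recoord (geom f $$ w))"
    using bij_is_inj[OF bij_recoord] by (simp add: inj_eq mps_eq_iff)
  also have "\<dots> \<longleftrightarrow> (\<forall>w. coeff_act (s_op w) (recoord f) = geom (recoord f) $$ w)"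
    by (auto simp: series_act_eq geom_nth recoord.mult recoord.power recoord.zero)
  also have "\<dots> \<longleftrightarrow> total_op coeff_act (recoord f) = geom (recoord f)"
    by (simp add: mps_eq_iff)
  finally show ?thesis .
qed

section \<open>The geometric series alpha(y_1 + y_2)\<close>

section \<open>Substitution of the sum of the variables\<close>

text \<open>The coefficients of g(x1 + x2) by the binomial theorem; here \<open>x1\<close> and
  \<open>x2\<close> stand for the coordinates y_1 and y_2.\<close>

definition subst_sum :: "ln_dual fps \<Rightarrow> dual_series" where
  "subst_sum g = series2 (\<lambda>i j. of_nat ((i + j) choose i) * g $ (i + j))"

lemma subst_sum_nth: "subst_sum g $ j $ i = of_nat ((i + j) choose i) * g $ (i + j)"
  by (simp add: subst_sum_def series2_def)

lemma ring_hom_const_series: "ring_hom const_series"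
  unfolding const_series_def by (rule ring_hom_comp[OF ring_hom_fps_const ring_hom_fps_const])

lemma const_series_mult_nth: "(const_series l * f) $ j $ i = l * f $ j $ i"
  by (simp add: const_series_def)

lemma power_x1_plus_x2_nth:
  "((x1 + x2) ^ n) $ j $ i = (if i + j = n then of_nat (n choose i) else 0)"
proof -
  interpret c: ring_hom const_series by (rule ring_hom_const_series)
  have nat: "of_nat k = const_series (of_nat k)" for k
    by (induction k) (simp_all add: c.zero c.one c.add)
  have "((x1 + x2) ^ n) $ j $ i =
      (\<Sum>k\<le>n. (const_series (of_nat (n choose k)) * x1 ^ k * x2 ^ (n - k)) $ j $ i)"
    by (simp add: binomial_ring fps_sum_nth flip: nat)
  also have "\<dots> = (\<Sum>k\<le>n. if k = i then (if i + j = n then of_nat (n choose i) else 0) else 0)"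
    unfolding nth_monomial by (intro sum.cong refl) auto
  finally show ?thesis by auto
qed

lemma subst_sum_truncated:
  assumes "i + j \<le> n"
  shows "subst_sum g $ j $ i = (\<Sum>k\<le>n. const_series (g $ k) * (x1 + x2) ^ k) $ j $ i"
proof -
  have "(\<Sum>k\<le>n. const_series (g $ k) * (x1 + x2) ^ k) $ j $ i =
      (\<Sum>k\<le>n. if k = i + j then of_nat ((i + j) choose i) * g $ (i + j) else 0)"
    unfolding fps_sum_nth const_series_mult_nth power_x1_plus_x2_nth
    by (intro sum.cong refl) (auto simp: mult.commute)
  then show ?thesis using assms by (simp add: subst_sum_nth)
qed

lemma ring_hom_subst_sum: "ring_hom subst_sum"
proof
  fix g h :: "ln_dual fps"
  show "subst_sum (g + h) = subst_sum g + subst_sum h"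
    by (intro fps_ext) (simp add: subst_sum_nth algebra_simps)
  show "subst_sum 1 = 1"
    by (intro fps_ext) (auto simp: subst_sum_nth)
  show "subst_sum (g * h) = subst_sum g * subst_sum h"
  proof (intro fps_ext)
    fix j i :: nat
    interpret c: ring_hom const_series by (rule ring_hom_const_series)
    define n where "n = i + j"
    let ?P = "\<lambda>g. \<Sum>k\<le>n. const_series (g $ k) * (x1 + x2) ^ k"
    have "(subst_sum g * subst_sum h) $ j $ i = (\<Sum>j'=0..j. \<Sum>i'=0..i.
        subst_sum g $ j' $ i' * subst_sum h $ (j - j') $ (i - i'))"
      by (simp add: fps_mult_nth fps_sum_nth)
    also have "\<dots> = (\<Sum>j'=0..j. \<Sum>i'=0..i. ?P g $ j' $ i' * ?P h $ (j - j') $ (i - i'))"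
      by (intro sum.cong refl) (auto simp: n_def intro!: arg_cong2[of _ _ _ _ "(*)"] subst_sum_truncated)
    also have "\<dots> = (?P g * ?P h) $ j $ i"
      by (simp only: fps_mult_nth fps_sum_nth)
    also have "\<dots> = ?P (g * h) $ j $ i"
    proof -
      have "?P (g * h) = (\<Sum>k\<le>n. (\<Sum>i\<le>k. const_series (g $ i) * const_series (h $ (k - i))) * (x1 + x2) ^ k)"
        by (intro sum.cong refl) (simp add: fps_mult_nth atLeast0AtMost c.sum c.mult)
      then have "(x1 + x2) ^ Suc n dvd ?P g * ?P h - ?P (g * h)"
        using truncated_product[of "x1 + x2" n "\<lambda>i. const_series (g $ i)" "\<lambda>i. const_series (h $ i)"]
        by simp
      then obtain r where "?P g * ?P h - ?P (g * h) = (x1 + x2) ^ Suc n * r" by blast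
      \<comment> \<open>A multiple of this power has no terms of total degree at most n = i +
        j.\<close>
      moreover have "((x1 + x2) ^ Suc n * r) $ j $ i = 0"
        unfolding fps_mult_nth fps_sum_nth power_x1_plus_x2_nth
        by (intro sum.neutral ballI) (auto simp: n_def)
      ultimately have "(?P g * ?P h - ?P (g * h)) $ j $ i = 0"
        by (simp only:)
      then show ?thesis by (simp only: fps_sub_nth right_minus_eq)
    qed
    also have "\<dots> = subst_sum (g * h) $ j $ i"
      by (rule subst_sum_truncated[symmetric]) (simp add: n_def)
    finally show "subst_sum (g * h) $ j $ i = (subst_sum g * subst_sum h) $ j $ i" ..
  qed
qed

lemma additive_of_nat_mult:
  assumes "additive f" shows "f (of_nat n * x) = of_nat n * f (x :: 'a::ring_1)"
proof -
  interpret additive f by fact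
  show ?thesis by (induction n) (simp_all add: zero add algebra_simps)
qed

text \<open>The binomial coefficients are integers, so \<open>subst_sum\<close> commutes with the
  coefficientwise operations.\<close>

lemma total_op_coeff_act_subst_sum_alpha:
  "total_op coeff_act (subst_sum alpha) = geom (subst_sum alpha)"
  by (rule total_op_transfer[OF ring_hom_subst_sum _ total_op_alpha])
     (auto intro!: fps_ext simp: coeff_act_def subst_sum_nth
       additive_of_nat_mult[OF cartan_action_additive(1)[OF cartan_action_Rstar]])

section \<open>The formal group law: existence and uniqueness\<close>

section \<open>Existence and uniqueness\<close>

lemma alpha_homogeneous: "fps_homogeneous dual_homogeneous 2 alpha"
proof -
  have "dual_homogeneous (2 - 2 * int n) (alpha $ n)" for n
  proof (cases n)
    case (Suc i)
    have "wt (coll_of_wt i) = i" using coll_of_wt_iff[of "coll_of_wt i" i] by simp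
    then show ?thesis
      by (simp add: Suc alpha_nth_Suc dual_homogeneous_def deg_eq_wt)
  qed (simp add: dual_homogeneous_def)
  then show ?thesis by (simp add: fps_homogeneous_def)
qed

text \<open>The two substitutions are undone in turn, x_2 first, each by
  \<open>homogeneous_of_compose\<close>.\<close>

lemma recoord_homogeneousD:
  assumes "series_homogeneous 2 (recoord f)"
  shows "series_homogeneous 2 f"
proof -
  interpret graded dual_homogeneous by (rule graded_dual_homogeneous)
  interpret fps: graded "fps_homogeneous dual_homogeneous"
    by (rule graded_fps_homogeneous[OF graded_dual_homogeneous])
  have const: "fps_homogeneous dual_homogeneous d (fps_const a)" if "dual_homogeneous d a" for d a
    using that by (simp add: fps_homogeneous_def)
  have "fps_homogeneous (fps_homogeneous dual_homogeneous) 2 (fps_map fps_const alpha)"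
    using alpha_homogeneous const by (simp add: fps_homogeneous_def)
  then have "fps_homogeneous (fps_homogeneous dual_homogeneous) 2 (fps_map (\<lambda>g. g oo alpha) f)"
    using assms unfolding series_homogeneous_eq recoord_def
    by - (rule homogeneous_of_compose[OF fps.graded_axioms]; simp add: alpha_nth_1)
  then have "fps_homogeneous dual_homogeneous (2 - 2 * int n) (f $ n oo alpha)" for n
    by (auto simp: fps_homogeneous_def[of "fps_homogeneous dual_homogeneous"])
  then have "fps_homogeneous dual_homogeneous (2 - 2 * int n) (f $ n)" for n
    by - (rule homogeneous_of_compose[OF graded_dual_homogeneous alpha_homogeneous];
        simp add: alpha_nth_1)
  then show ?thesis
    by (simp add: series_homogeneous_eq fps_homogeneous_def[of "fps_homogeneous dual_homogeneous"])
qed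

lemma subst_sum_alpha_homogeneous: "series_homogeneous 2 (subst_sum alpha)"
  unfolding series_homogeneous_def
proof (intro allI)
  fix i j
  have "dual_homogeneous d (of_nat k * l)" if "dual_homogeneous d l" for d k l
    using that graded.sum[OF graded_dual_homogeneous, of "{..<k}" d "\<lambda>_. l"] by simp
  moreover have "dual_homogeneous (2 - 2 * int i - 2 * int j) (alpha $ (i + j))"
    using alpha_homogeneous unfolding fps_homogeneous_def
    by (metis diff_diff_eq distrib_left of_nat_add)
  ultimately show "dual_homogeneous (2 - 2 * int i - 2 * int j) (subst_sum alpha $ j $ i)"
    by (simp add: subst_sum_nth)
qed

text \<open>The formal group law with exponential \<open>alpha\<close>: f(alpha(y_1), alpha(y_2)) =
  alpha(y_1 + y_2).\<close>

definition fgl :: dual_series where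
  "fgl = inv recoord (subst_sum alpha)"

lemma recoord_fgl: "recoord fgl = subst_sum alpha"
  by (simp add: fgl_def)

lemma geometric_cobordism_fgl: "geometric_cobordism fgl"
  by (simp add: geometric_cobordism_def geometric_values_series_act recoord_fgl
      total_op_coeff_act_subst_sum_alpha recoord_homogeneousD subst_sum_alpha_homogeneous)

lemma compose_alpha_eq_alphaD:
  assumes "g oo alpha = alpha" shows "g = fps_X"
proof -
  have "inj (\<lambda>a. a oo alpha)"
    by (intro bij_is_inj bij_fps_compose) (simp_all add: alpha_nth_1)
  then show ?thesis
    using assms by (auto dest!: injD[of _ g fps_X])
qed

text \<open>Setting y_2 = 0 gives f(alpha(y_1), 0) = alpha(y_1), and substitution of
  \<open>alpha\<close> is injective.\<close>

lemma fgl_nth_0: "fgl $ 0 = fps_X"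
proof (rule compose_alpha_eq_alphaD)
  have "fgl $ 0 oo alpha = recoord fgl $ 0"
    by (simp add: recoord_def)
  also have "\<dots> = alpha"
    unfolding recoord_fgl by (rule fps_ext) (simp add: subst_sum_nth)
  finally show "fgl $ 0 oo alpha = alpha" .
qed

lemma fgl_nth_nth_0: "fgl $ j $ 0 = fps_X $ j"
proof -
  have hom: "ring_hom (\<lambda>g :: ln_dual fps. g $ 0)"
    by standard simp_all
  let ?p = "fps_map (\<lambda>g :: ln_dual fps. g $ 0)"
  \<comment> \<open>\<open>?p\<close> sets y_1 = 0. The inner substitution leaves constant terms
    alone because \<open>alpha\<close> has none, and \<open>?p\<close> turns
    \<open>fps_map fps_const alpha\<close> back into \<open>alpha\<close>.\<close>
  have "?p fgl oo alpha = ?p (fps_map (\<lambda>g. g oo alpha) fgl) oo ?p (fps_map fps_const alpha)"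
    by (rule arg_cong2[of _ _ _ _ "(oo)"]; rule fps_ext; simp)
  also have "\<dots> = ?p (recoord fgl)"
    by (simp add: recoord_def fps_map_compose[OF hom])
  also have "\<dots> = alpha"
    unfolding recoord_fgl by (rule fps_ext) (simp add: subst_sum_nth)
  finally have "?p fgl = fps_X" by (rule compose_alpha_eq_alphaD)
  then show ?thesis by (metis fps_nth_map)
qed

lemma fgl_form: "fgl = x1 + x2 + series2 (\<lambda>i j. if 1 \<le> i \<and> 1 \<le> j then fgl $ j $ i else 0)"
proof (intro fps_ext)
  fix j i
  show "fgl $ j $ i =
      (x1 + x2 + series2 (\<lambda>i j. if 1 \<le> i \<and> 1 \<le> j then fgl $ j $ i else 0)) $ j $ i"
    by (cases j; cases i)
       (auto simp: x1_def x2_def series2_def fgl_nth_0 fgl_nth_nth_0 fps_X_def)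
qed

definition dual_counit :: "ln_dual \<Rightarrow> int" where
  "dual_counit l = Poly_Mapping.lookup l {#}"

lemma ring_hom_dual_counit: "ring_hom dual_counit"
  by standard (simp_all add: dual_counit_def lookup_add lookup_dual_mult splittings_empty lookup_one)

definition counit_series :: "dual_series \<Rightarrow> int fps fps" where
  "counit_series = fps_map (fps_map dual_counit)"

lemma ring_hom_counit_series: "ring_hom counit_series"
  unfolding counit_series_def by (intro ring_hom_fps_map ring_hom_dual_counit)

lemma counit_alpha: "fps_map dual_counit alpha = fps_X"
proof (rule fps_ext)
  show "fps_map dual_counit alpha $ n = fps_X $ n" for n
    using lookup_alpha_power[of 1 n "{#}"]
    by (cases n) (auto simp: dual_counit_def geom_nth fps_X_def)
qed

text \<open>The counit reduces alpha(y) to y, so the change of coordinates becomes the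
  identity.\<close>

lemma counit_series_recoord: "counit_series (recoord f) = counit_series f"
proof -
  have inner: "fps_map dual_counit (g oo alpha) = fps_map dual_counit g" for g
    by (simp add: fps_map_compose[OF ring_hom_dual_counit] counit_alpha)
  have "counit_series (recoord f) = counit_series (fps_map (\<lambda>g. g oo alpha) f) oo
      counit_series (fps_map fps_const alpha)"
    unfolding recoord_def counit_series_def
    by (rule fps_map_compose[OF ring_hom_fps_map[OF ring_hom_dual_counit]])
  also have "counit_series (fps_map (\<lambda>g. g oo alpha) f) = counit_series f"
    by (rule fps_ext) (simp add: counit_series_def inner)
  also have "counit_series (fps_map fps_const alpha) = fps_X"
  proof (rule fps_ext)
    fix n
    have "fps_map dual_counit (fps_const (alpha $ n)) = fps_const (fps_X $ n)"
      by (subst fps_map_const) (simp_all add: dual_counit_def flip: counit_alpha)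
    then show "counit_series (fps_map fps_const alpha) $ n = fps_X $ n"
      by (simp add: counit_series_def fps_X_def)
  qed
  finally show ?thesis by simp
qed

text \<open>
  In \<open>coeff_act\<close>-coordinates a geometric series is determined by its reduction along the counit:
  the coefficient of \<open>s\<^sup>*\<^sub>w\<close> is recovered by evaluating \<open>s\<^sub>w f\<close> at the counit.
\<close>

lemma lookup_geometric:
  assumes "total_op coeff_act f = geom f"
  shows "Poly_Mapping.lookup (f $ j $ i) w =
    (if size w \<le> 1 then (counit_series f ^ (wt w + 1)) $ j $ i else 0)"
proof -
  interpret E: ring_hom counit_series by (rule ring_hom_counit_series)
  have "Poly_Mapping.lookup (f $ j $ i) w = counit_series (coeff_act (s_op w) f) $ j $ i"
    by (simp add: counit_series_def coeff_act_def dual_counit_def lookup_Rstar ln_mult_unit pairing_s_op)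
  also have "coeff_act (s_op w) f = geom f $$ w"
    using assms by (simp add: mps_eq_iff)
  also have "counit_series (geom f $$ w) = (if size w \<le> 1 then counit_series f ^ (wt w + 1) else 0)"
    by (simp add: geom_nth E.zero E.mult E.power)
  finally show ?thesis by simp
qed

lemma counit_series_of_form:
  assumes form: "\<exists>\<alpha>. f = x1 + x2 + series2 (\<lambda>i j. if 1 \<le> i \<and> 1 \<le> j then \<alpha> i j else 0)"
    and hom: "series_homogeneous 2 f"
  shows "counit_series f = counit_series (x1 + x2)"
proof (intro fps_ext)
  fix j i
  show "counit_series f $ j $ i = counit_series (x1 + x2) $ j $ i"
  proof (cases "i = 0 \<or> j = 0")
    case True
    with form have "f $ j $ i = (x1 + x2) $ j $ i"
      by (auto simp: series2_def)
    then show ?thesis by (simp add: counit_series_def)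
  next
    case False
    \<comment> \<open>For i, j at least 1 the coefficient has degree 2 - 2i - 2j, which is negative,
      while the empty collection has degree 0.\<close>
    then have "{#} \<notin> Poly_Mapping.keys (f $ j $ i)"
      using hom by (force simp: series_homogeneous_def dual_homogeneous_def deg_def)
    then have "dual_counit (f $ j $ i) = 0"
      by (simp add: dual_counit_def in_keys_iff)
    moreover have "(x1 + x2) $ j $ i = 0"
      using False by (simp add: x1_def x2_def fps_X_def)
    ultimately show ?thesis
      by (simp add: counit_series_def dual_counit_def)
  qed
qed

theorem lemma2:
  "\<exists>!f :: dual_series.
     (\<exists>\<alpha> :: nat \<Rightarrow> nat \<Rightarrow> ln_dual.
        f = x1 + x2 + series2 (\<lambda>i j. if 1 \<le> i \<and> 1 \<le> j then \<alpha> i j else 0)) \<and>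
     geometric_cobordism f"
proof (rule ex_ex1I)
  show "\<exists>f. (\<exists>\<alpha>. f = x1 + x2 + series2 (\<lambda>i j. if 1 \<le> i \<and> 1 \<le> j then \<alpha> i j else 0)) \<and>
      geometric_cobordism f"
    using fgl_form geometric_cobordism_fgl
    by (intro exI[of _ fgl] conjI exI[of _ "\<lambda>i j. fgl $ j $ i"])
next
  fix f g :: dual_series
  assume f: "(\<exists>\<alpha>. f = x1 + x2 + series2 (\<lambda>i j. if 1 \<le> i \<and> 1 \<le> j then \<alpha> i j else 0)) \<and>
      geometric_cobordism f"
    and g: "(\<exists>\<alpha>. g = x1 + x2 + series2 (\<lambda>i j. if 1 \<le> i \<and> 1 \<le> j then \<alpha> i j else 0)) \<and>
      geometric_cobordism g"
  have "counit_series f = counit_series (x1 + x2)" "counit_series g = counit_series (x1 + x2)"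
    using f g by (simp_all only: geometric_cobordism_def counit_series_of_form)
  then have "counit_series (recoord f) = counit_series (recoord g)"
    by (simp add: counit_series_recoord)
  moreover have "total_op coeff_act (recoord f) = geom (recoord f)"
    "total_op coeff_act (recoord g) = geom (recoord g)"
    using f g by (simp_all add: geometric_cobordism_def geometric_values_series_act)
  \<comment> \<open>By \<open>lookup_geometric\<close> every coefficient of both series is
    determined by their common reduction along the counit.\<close>
  ultimately have "recoord f = recoord g"
    by (intro fps_ext poly_mapping_eqI) (simp add: lookup_geometric)
  then show "f = g" by (metis recoord_inv(2))
qed

end
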